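(* Let $d\ge 2$ and let $\lambda=(\lambda_1,\dots,\lambda_d)\in\mathbb{R}^d$ and $\tau=(\tau_1,\dots,\tau_d)\in\mathbb{R}^d$ be fixed. Suppose $$0>\lambda_1>\lambda_2\ge\cdots\ge\lambda_d .$$ Let $f(\lambda,\tau,r)$ be the Fisher-Bingham integral over the sphere of radius $r$ in $\mathbb{R}^d$. Then, as $r\to\infty$, \begin{align*} f(\lambda,\tau,r)&=\frac{\pi^{(d-1)/2}}{\prod_{i=2}^d(\lambda_1-\lambda_i)^{1/2}}\,\bigl(e^{r\tau_1}+e^{-r\tau_1}\bigr)\exp\left(r^2\lambda_1-\sum_{i=2}^d\frac{\tau_i^2}{4(\lambda_i-\lambda_1)}\right)(1+o(1)),\\ \partial_{\lambda_1}f(\lambda,\tau,r)&=r^2 f(\lambda,\tau,r)(1+o(1)),\\ \partial_{\lambda_j}f(\lambda,\tau,r)&=\left\{\left(\frac{\tau_j}{2(\lambda_j-\lambda_1)}\right)^2+\frac{1}{2(\lambda_1-\lambda_j)}\right\}f(\lambda,\tau,r)(1+o(1)),\quad j=2,\dots,d,\\ \partial_{\tau_1}f(\lambda,\tau,r)&=r\,\frac{e^{r\tau_1}-e^{-r\tau_1}}{e^{r\tau_1}+e^{-r\tau_1}}\,f(\lambda,\tau,r)(1+o(1)),\\ \partial_{\tau_j}f(\lambda,\tau,r)&=\frac{\tau_j}{2(\lambda_1-\lambda_j)}\,f(\lambda,\tau,r)(1+o(1)),\quad j=2,\dots,d. \end{align*}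
   Context: For $r>0$, $\lambda,\tau\in\mathbb{R}^d$, the Fisher-Bingham integral is $$f(\lambda,\tau,r)=\int_{S^{d-1}(r)}\exp\left(\sum_{i=1}^d\lambda_i t_i^2+\sum_{i=1}^d\tau_i t_i\right)d\mathbf{t},$$ where $S^{d-1}(r)=\{\mathbf{t}\in\mathbb{R}^d : t_1^2+\cdots+t_d^2=r^2\}$ is the sphere of radius $r$ and $d\mathbf{t}$ is its volume element (surface measure), normalized so that $\int_{S^{d-1}(r)}d\mathbf{t}=r^{d-1}\cdot\frac{2\pi^{d/2}}{\Gamma(d/2)}$. The symbols $\partial_{\lambda_j}$ and $\partial_{\tau_j}$ denote partial derivatives with respect to $\lambda_j$ and $\tau_j$, where $f$ is regarded as a function of the $2d$ independent real variables $\lambda_1,\dots,\lambda_d,\tau_1,\dots,\tau_d$ (and $r$). The notation $A(r)=B(r)(1+o(1))$ as $r\to\infty$ means that $A(r)=B(r)(1+\varepsilon(r))$ for some function $\varepsilon$ with $\varepsilon(r)\to 0$ as $r\to\infty$ (with $\lambda,\tau$ fixed). *)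

theory Defs
  imports "HOL-Analysis.Analysis"
begin

section \<open>Surface measure on a sphere\<close>

text \<open>
  HOL-Analysis has no surface measure on spheres. We use the usual polar-coordinate (cone)
  definition: the area of a Borel set \<open>A\<close> in the sphere of radius \<open>r > 0\<close> around the origin of a
  \<open>d\<close>-dimensional space is \<open>d / r\<close> times the volume of the cone
  \<open>{x. 0 < norm x \<le> r \<and> (r / norm x) x \<in> A}\<close> over \<open>A\<close> (height \<open>r\<close>, volume = area times height
  divided by \<open>d\<close>).
  This is the Riemannian volume element. Up to a constant factor it is the unique finite
  rotation-invariant Borel measure on the sphere; \<open>distr_sphere_measure_orthogonal\<close> and
  \<open>emeasure_sphere_measure_space\<close> below establish the invariance and the constant. (The sort
  \<open>wellorder\<close> of the index type in the former comes from the library fact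
  \<open>measure_orthogonal_image\<close>.)
\<close>

definition sphere_measure :: "real \<Rightarrow> 'a::euclidean_space measure" where
  "sphere_measure r =
     density
       (distr (restrict_space lborel (cball 0 r - {0})) (restrict_space borel (sphere 0 r))
         (\<lambda>x. (r / norm x) *\<^sub>R x))
       (\<lambda>_. ennreal (real DIM('a) / r))"

lemma space_sphere_measure [simp]: "space (sphere_measure r) = sphere 0 r"
  by (simp add: sphere_measure_def space_restrict_space)

lemma sets_sphere_measure [simp, measurable_cong]:
  "sets (sphere_measure r) = sets (restrict_space borel (sphere 0 r))"
  by (simp add: sphere_measure_def)

lemma radial_projection_measurable:
  assumes "r > 0"
  shows "(\<lambda>x. (r / norm x) *\<^sub>R x)
    \<in> restrict_space lborel (cball 0 r - {0}) \<rightarrow>\<^sub>M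
      restrict_space borel (sphere 0 r :: 'a::euclidean_space set)"
proof (rule measurable_restrict_space2)
  show "(\<lambda>x::'a. (r / norm x) *\<^sub>R x)
      \<in> space (restrict_space lborel (cball 0 r - {0})) \<rightarrow> sphere 0 r"
    using assms by (auto simp: space_restrict_space)
  show "(\<lambda>x::'a. (r / norm x) *\<^sub>R x) \<in> restrict_space lborel (cball 0 r - {0}) \<rightarrow>\<^sub>M borel"
    by (rule measurable_restrict_space1) measurable
qed

lemma emeasure_sphere_measure:
  fixes A :: "'a::euclidean_space set"
  assumes r: "r > 0" and A: "A \<in> sets borel" "A \<subseteq> sphere 0 r"
  shows "emeasure (sphere_measure r) A =
    ennreal (real DIM('a) / r) *
    emeasure lborel {x. 0 < norm x \<and> norm x \<le> r \<and> (r / norm x) *\<^sub>R x \<in> A}"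
proof -
  let ?p = "\<lambda>x::'a. (r / norm x) *\<^sub>R x"
  let ?R = "restrict_space lborel (cball 0 r - {0::'a})"
  let ?S = "restrict_space borel (sphere 0 r :: 'a set)"
  have A': "A \<in> sets ?S"
    using A by (auto simp: sets_restrict_space)
  have "emeasure (sphere_measure r) A = ennreal (real DIM('a) / r) * emeasure (distr ?R ?S ?p) A"
    unfolding sphere_measure_def using A' by (subst emeasure_density_const) auto
  also have "emeasure (distr ?R ?S ?p) A = emeasure ?R (?p -` A \<inter> space ?R)"
    using A' by (intro emeasure_distr radial_projection_measurable r)
  also have "\<dots> = emeasure lborel (?p -` A \<inter> space ?R)"
    by (rule emeasure_restrict_space) (auto simp: space_restrict_space)
  also have "?p -` A \<inter> space ?R = {x. 0 < norm x \<and> norm x \<le> r \<and> (r / norm x) *\<^sub>R x \<in> A}"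
    by (auto simp: space_restrict_space)
  finally show ?thesis .
qed

lemma emeasure_sphere_measure_space:
  assumes r: "r > 0"
  shows "emeasure (sphere_measure r) (sphere 0 r :: 'a::euclidean_space set) =
    ennreal (r ^ (DIM('a) - 1) * (2 * pi powr (DIM('a) / 2) / Gamma (DIM('a) / 2)))"
proof -
  have eq: "{x::'a. 0 < norm x \<and> norm x \<le> r \<and> (r / norm x) *\<^sub>R x \<in> sphere 0 r} = cball 0 r - {0}"
    using r by auto
  have "emeasure lborel (cball 0 r - {0::'a}) = emeasure lborel (cball 0 r :: 'a set)"
    by (rule emeasure_Diff_null_set) auto
  also have "\<dots> = ennreal (unit_ball_vol (DIM('a)) * r ^ DIM('a))"
    using r by (intro emeasure_cball) auto
  finally have "emeasure (sphere_measure r) (sphere 0 r :: 'a set) =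
      ennreal (real DIM('a) / r) * ennreal (unit_ball_vol (DIM('a)) * r ^ DIM('a))"
    using r by (subst emeasure_sphere_measure) (auto simp only: eq, auto)
  also have "\<dots> = ennreal (real DIM('a) / r * (unit_ball_vol (DIM('a)) * r ^ DIM('a)))"
    using r by (subst ennreal_mult) auto
  also have "r ^ DIM('a) = r * r ^ (DIM('a) - 1)"
    by (simp flip: power_Suc)
  also have "real DIM('a) / r * (unit_ball_vol (DIM('a)) * (r * r ^ (DIM('a) - 1))) =
      r ^ (DIM('a) - 1) * (2 * pi powr (DIM('a) / 2) / Gamma (DIM('a) / 2))"
  proof -
    have "Gamma (real DIM('a) / 2 + 1) = real DIM('a) / 2 * Gamma (real DIM('a) / 2)"
      by (rule Gamma_plus1) (use DIM_positive[where 'a='a] in \<open>auto dest: nonpos_Ints_nonpos\<close>)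
    then have vol: "unit_ball_vol (real DIM('a)) =
        pi powr (DIM('a) / 2) / (real DIM('a) / 2 * Gamma (DIM('a) / 2))"
      by (simp only: unit_ball_vol_def)
    have "Gamma (real DIM('a) / 2) > 0"
      by (rule Gamma_real_pos) auto
    then show ?thesis
      unfolding vol using r by (simp add: divide_simps)
  qed
  finally show ?thesis .
qed

lemma distr_sphere_measure_orthogonal:
  fixes T :: "real ^ 'n::{finite,wellorder} \<Rightarrow> real ^ 'n::_"
  assumes r: "r > 0" and T: "orthogonal_transformation T"
  shows "distr (sphere_measure r) (sphere_measure r) T = sphere_measure r"
proof (rule measure_eqI)
  have lin: "linear T" and norm: "norm (T x) = norm x" for x
    using T by (auto simp: orthogonal_transformation)
  have T0: "T x = 0 \<longleftrightarrow> x = 0" for x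
    by (metis norm norm_eq_zero)
  have cont: "continuous_on UNIV T"
    using lin by (simp add: linear_continuous_on linear_conv_bounded_linear)
  have [measurable]: "T \<in> borel_measurable borel"
    using cont by (rule borel_measurable_continuous_onI)
  have Tm: "T \<in> sphere_measure r \<rightarrow>\<^sub>M sphere_measure r"
    by (auto simp: measurable_cong_sets[OF sets_sphere_measure sets_sphere_measure] norm
        intro!: measurable_restrict_space3)
  fix A assume "A \<in> sets (distr (sphere_measure r) (sphere_measure r) T)"
  then have A: "A \<in> sets (sphere_measure r)" by simp
  then have A': "A \<in> sets borel" "A \<subseteq> sphere 0 r"
    by (auto simp: sets_restrict_space)
  define C where "C B = {x::real ^ 'n::_. 0 < norm x \<and> norm x \<le> r \<and> (r / norm x) *\<^sub>R x \<in> B}" for B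
  have C: "C B \<in> lmeasurable" "C B \<in> sets borel" if [measurable]: "B \<in> sets borel" for B
  proof -
    show *: "C B \<in> sets borel" unfolding C_def by measurable
    have "bounded (C B)"
      by (rule bounded_subset[of "cball 0 r"]) (auto simp: C_def)
    then show "C B \<in> lmeasurable"
      using * by (intro bounded_set_imp_lmeasurable) auto
  qed
  have em: "emeasure lborel (C B) = ennreal (measure lebesgue (C B))" if "B \<in> sets borel" for B
  proof -
    have "emeasure lborel (C B) = emeasure lebesgue (C B)"
      using C(2)[OF that] by simp
    also have "\<dots> = ennreal (measure lebesgue (C B))"
      using C(1)[OF that] by (intro emeasure_eq_measure2)
    finally show ?thesis .
  qed
  let ?B = "T -` A \<inter> sphere 0 r"
  have B: "?B \<in> sets borel" using A'(1)
    by (intro sets.Int measurable_sets_borel[of T borel]) auto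
  have "T ` C ?B = C A"
  proof (intro equalityI subsetI)
    fix y assume "y \<in> T ` C ?B"
    then obtain x where "x \<in> C ?B" "y = T x" by blast
    then show "y \<in> C A" by (simp add: C_def norm T0 linear_cmul[OF lin])
  next
    fix y assume y: "y \<in> C A"
    obtain x where x: "y = T x"
      using orthogonal_transformation_surj[OF T] by (metis surjD)
    have "x \<in> C ?B"
      using y r by (auto simp: C_def x norm T0 linear_cmul[OF lin])
    then show "y \<in> T ` C ?B" using x by blast
  qed
  then have "measure lebesgue (C ?B) = measure lebesgue (C A)"
    using measure_orthogonal_image[OF T C(1)[OF B]] by simp
  then have "emeasure lborel (C ?B) = emeasure lborel (C A)"
    by (simp add: em[OF B] em[OF A'(1)])
  then have "emeasure (sphere_measure r) ?B = emeasure (sphere_measure r) A"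
    using emeasure_sphere_measure[OF r B] emeasure_sphere_measure[OF r A'] by (simp add: C_def)
  then show "emeasure (distr (sphere_measure r) (sphere_measure r) T) A =
      emeasure (sphere_measure r) A"
    using emeasure_distr[OF Tm A] by simp
qed simp


section \<open>The Fisher-Bingham integral\<close>

definition fisher_bingham :: "real ^ 'n::finite \<Rightarrow> real ^ 'n \<Rightarrow> real \<Rightarrow> real" where
  "fisher_bingham lam tau r =
     (LINT t|sphere_measure r. exp ((\<Sum>i\<in>UNIV. lam $ i * (t $ i)\<^sup>2) + (\<Sum>i\<in>UNIV. tau $ i * t $ i)))"

definition partially_differentiable :: "'n \<Rightarrow> (real ^ 'n::finite \<Rightarrow> real) \<Rightarrow> real ^ 'n \<Rightarrow> bool" where
  "partially_differentiable j F x \<longleftrightarrow>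
     (\<lambda>h. F (x + h *\<^sub>R axis j 1)) differentiable (at 0)"

definition partial_deriv :: "'n \<Rightarrow> (real ^ 'n::finite \<Rightarrow> real) \<Rightarrow> real ^ 'n \<Rightarrow> real" where
  "partial_deriv j F x = deriv (\<lambda>h. F (x + h *\<^sub>R axis j 1)) 0"

text \<open>
  \<open>A(r) = B(r) (1 + o(1))\<close> as \<open>r \<rightarrow> \<infinity>\<close>, for functions on the positive reals. In particular \<open>A\<close>
  vanishes wherever \<open>B\<close> does.
\<close>

definition eq_times_1_plus_o1 :: "(real \<Rightarrow> real) \<Rightarrow> (real \<Rightarrow> real) \<Rightarrow> bool" where
  "eq_times_1_plus_o1 A B \<longleftrightarrow>
     (\<exists>\<epsilon>. (\<epsilon> \<longlongrightarrow> 0) at_top \<and> (\<forall>r>0. A r = B r * (1 + \<epsilon> r)))"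

end

theory Submission
  imports Defs "HOL-Probability.Distributions"
begin

text \<open>
  Write \<open>k\<close> for the index of the largest \<open>\<lambda>\<^sub>i\<close>. On the sphere \<open>\<Sum>t\<^sub>i\<^sup>2 = r\<^sup>2\<close>, so the quadratic form
  equals \<open>r\<^sup>2 \<lambda>\<^sub>k - \<Sum>\<^bsub>i\<noteq>k\<^esub> (\<lambda>\<^sub>k - \<lambda>\<^sub>i) t\<^sub>i\<^sup>2\<close> with all coefficients \<open>\<lambda>\<^sub>k - \<lambda>\<^sub>i\<close> positive, and for
  large \<open>r\<close> most of the mass of the integrand sits at bounded distance from the two poles
  \<open>t = (\<plusminus>r, 0)\<close>. There the sphere is nearly flat, so the integral over either cap tends to a Gaussian
  integral over the remaining \<open>d - 1\<close> coordinates, and the two poles contribute with weights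
  \<open>exp (\<plusminus> r \<tau>\<^sub>k)\<close>. The partial derivatives of the Fisher-Bingham integral are the moments of \<open>t\<^sub>j\<close> and
  \<open>t\<^sub>j\<^sup>2\<close> (differentiation under the integral sign), so the same limit gives the remaining four
  formulas: the moments with \<open>j \<noteq> k\<close> become Gaussian moments, while \<open>t\<^sub>k\<close> is \<open>\<plusminus>r\<close> up to
  \<open>1 + o(1)\<close>.

  The caps are parametrized by the gnomonic projection: \<open>w\<close> in the tangent space at a pole
  \<open>(\<sigma>r, 0)\<close>, with \<open>\<sigma> = \<plusminus>1\<close>, is sent to \<open>(\<sigma>r, w) / s\<close>, where \<open>s = sqrt (1 + \<bar>w\<bar>\<^sup>2 / r\<^sup>2)\<close>. For a surface
  measure defined through volumes of cones this is the natural chart: slicing the cone by the hyperplanes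
  \<open>x\<^sub>k = y\<close> and rescaling each slice by \<open>\<bar>y\<bar> / r\<close> shows that the surface element is \<open>s\<^sup>-\<^sup>d dw\<close>
  (\<open>nn_integral_sphere_gnomonic\<close>), using only linear substitutions and Fubini. The chart covers a whole
  open hemisphere, so the tangent-space integrals need no cut-off and
  dominated convergence applies on the whole tangent space (\<open>laplace_integral_tendsto\<close>). The
  dominating function is a constant times \<open>(1 + \<bar>w\<bar>\<^sup>2)\<^bsup>-d/2\<^esup>\<close>, which is integrable because it is the
  surface density of the unit sphere.

  A relation \<open>A(r) = B(r) (1 + o(1))\<close> for all \<open>r > 0\<close> forces \<open>A\<close> to vanish where \<open>B\<close> does. Here \<open>B\<close> vanishes
  only in the formulas for \<open>\<partial>f/\<partial>\<tau>\<^sub>j\<close>, and exactly when \<open>\<tau>\<^sub>j = 0\<close>; then the derivative is the integral of an odd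
  function (\<open>sphere_moment_eq_0_if_odd\<close>).
\<close>

section \<open>Lebesgue measure on coordinate spaces\<close>

interpretation lborel_product: product_sigma_finite "\<lambda>_::'i. lborel :: real measure" ..

lemma measurable_vec_lambda [measurable (raw)]:
  fixes f :: "'n::finite \<Rightarrow> 'a \<Rightarrow> real"
  assumes "\<And>i. f i \<in> borel_measurable M"
  shows "(\<lambda>x. \<chi> i. f i x) \<in> borel_measurable M"
  unfolding borel_measurable_euclidean_space[of "\<lambda>x. \<chi> i. f i x"]
  using assms by (auto simp: Basis_vec_def inner_axis)

text \<open>
  Passing to a product measure indexed by coordinates makes it possible to split off the single
  coordinate \<open>k\<close> and to use product integrals over an index set that is not a type.
\<close>

lemma lborel_vec_eq_distr_PiM:
  "(lborel :: (real ^ 'n::finite) measure) = distr (PiM UNIV (\<lambda>_. lborel)) borel (\<lambda>f. \<chi> i. f i)"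
proof (rule lborel_eqI)
  fix l u :: "real ^ 'n"
  assume lu: "\<And>b. b \<in> Basis \<Longrightarrow> l \<bullet> b \<le> u \<bullet> b"
  have le: "l $ i \<le> u $ i" for i
    using lu[of "axis i 1"] by (auto simp: inner_axis Basis_vec_def)
  have "emeasure (distr (PiM UNIV (\<lambda>_. lborel)) borel (\<lambda>f. \<chi> i. f i)) (box l u) =
      emeasure (PiM UNIV (\<lambda>_. lborel)) ((\<lambda>f. \<chi> i. f i) -` box l u \<inter> space (PiM UNIV (\<lambda>_::'n. lborel :: real measure)))"
    by (subst emeasure_distr) auto
  also have "(\<lambda>f. \<chi> i. f i) -` box l u \<inter> space (PiM UNIV (\<lambda>_::'n. lborel :: real measure)) =
      PiE UNIV (\<lambda>i. {l $ i <..< u $ i})"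
    by (auto simp: space_PiM PiE_def Pi_def mem_box_cart)
  also have "emeasure (PiM UNIV (\<lambda>_. lborel)) \<dots> = (\<Prod>i\<in>UNIV. ennreal (u $ i - l $ i))"
    by (subst lborel_product.emeasure_PiM) (auto simp: le)
  also have "\<dots> = ennreal (\<Prod>i\<in>UNIV. u $ i - l $ i)"
    by (rule prod_ennreal) (simp add: le)
  also have "(\<Prod>i\<in>UNIV. u $ i - l $ i) = (\<Prod>b\<in>Basis. (u - l) \<bullet> b)"
  proof -
    have "(\<Prod>b\<in>Basis. (u - l) \<bullet> b) = (\<Prod>b\<in>range (\<lambda>i. axis i 1). (u - l) \<bullet> b)"
      by (rule prod.cong) (auto simp: Basis_vec_def)
    also have "\<dots> = (\<Prod>i\<in>UNIV. u $ i - l $ i)"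
      by (subst prod.reindex) (auto simp: inj_on_def axis_eq_axis inner_axis)
    finally show ?thesis by simp
  qed
  finally show "emeasure (distr (PiM UNIV (\<lambda>_. lborel)) borel (\<lambda>f. \<chi> i. f i)) (box l u) =
      ennreal (\<Prod>b\<in>Basis. (u - l) \<bullet> b)" .
qed simp

text \<open>
  Both sides agree on boxes, where the claim is the one-dimensional substitution rule in each coordinate.
\<close>

lemma PiM_lborel_scale:
  fixes c :: "'i \<Rightarrow> real"
  assumes I: "finite I" and c: "\<And>i. i \<in> I \<Longrightarrow> c i \<noteq> 0"
  shows "density
      (distr (PiM I (\<lambda>_. lborel)) (PiM I (\<lambda>_. lborel)) (\<lambda>w. \<lambda>i\<in>I. c i * w i))
      (\<lambda>_. ennreal (\<Prod>i\<in>I. \<bar>c i\<bar>)) = PiM I (\<lambda>_. lborel)"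
proof -
  let ?P = "PiM I (\<lambda>_::'i. lborel :: real measure)" and ?S = "\<lambda>w. \<lambda>i\<in>I. c i * w i"
  have S [measurable]: "?S \<in> ?P \<rightarrow>\<^sub>M ?P" by measurable
  let ?D = "density (distr ?P ?P ?S) (\<lambda>_. ennreal (\<Prod>i\<in>I. \<bar>c i\<bar>))"
  show "?D = ?P"
  proof (rule lborel_product.PiM_eqI[OF I])
    fix A :: "'i \<Rightarrow> real set" assume A: "\<And>i. i \<in> I \<Longrightarrow> A i \<in> sets lborel"
    have A' [measurable]: "Pi\<^sub>E I A \<in> sets ?P"
      using I A by (intro sets_PiM_I_finite) auto
    have m: "(*) (c i) -` A i \<in> sets borel" if "i \<in> I" for i
    proof -
      have "(\<lambda>x. c i * x) \<in> borel_measurable borel" by measurable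
      from measurable_sets[OF this, of "A i"] show ?thesis using A[OF that] by simp
    qed
    have "emeasure ?D (Pi\<^sub>E I A) = ennreal (\<Prod>i\<in>I. \<bar>c i\<bar>) * emeasure (distr ?P ?P ?S) (Pi\<^sub>E I A)"
      by (subst emeasure_density_const) auto
    also have "emeasure (distr ?P ?P ?S) (Pi\<^sub>E I A) = emeasure ?P (?S -` Pi\<^sub>E I A \<inter> space ?P)"
      by (subst emeasure_distr) auto
    also have "?S -` Pi\<^sub>E I A \<inter> space ?P = Pi\<^sub>E I (\<lambda>i. (\<lambda>x. c i * x) -` A i)"
      by (auto simp: space_PiM PiE_def Pi_def)
    also have "emeasure ?P \<dots> = (\<Prod>i\<in>I. emeasure lborel ((\<lambda>x. c i * x) -` A i))"
      by (subst lborel_product.emeasure_PiM) (auto simp: I m)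
    also have "ennreal (\<Prod>i\<in>I. \<bar>c i\<bar>) * \<dots> =
        (\<Prod>i\<in>I. ennreal \<bar>c i\<bar> * emeasure lborel ((\<lambda>x. c i * x) -` A i))"
      by (simp add: prod_ennreal prod.distrib)
    also have "\<dots> = (\<Prod>i\<in>I. emeasure lborel (A i))"
    proof (rule prod.cong[OF refl])
      fix i assume i: "i \<in> I"
      have "emeasure lborel (A i) =
          emeasure (density (distr lborel borel (\<lambda>x. 0 + c i * x)) (\<lambda>_. ennreal \<bar>c i\<bar>)) (A i)"
        using lborel_real_affine[OF c[OF i], of 0] by simp
      also have "\<dots> = ennreal \<bar>c i\<bar> * emeasure lborel ((\<lambda>x. c i * x) -` A i)"
        using A[OF i] by (subst emeasure_density_const) (auto simp: emeasure_distr)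
      finally show "ennreal \<bar>c i\<bar> * emeasure lborel ((\<lambda>x. c i * x) -` A i) = emeasure lborel (A i)"
        by simp
    qed
    finally show "emeasure ?D (Pi\<^sub>E I A) = (\<Prod>i\<in>I. emeasure lborel (A i))" .
  qed simp
qed

lemma nn_integral_PiM_lborel_scale:
  fixes c :: "'i \<Rightarrow> real"
  assumes I: "finite I" and c: "\<And>i. i \<in> I \<Longrightarrow> c i \<noteq> 0"
    and f: "f \<in> borel_measurable (PiM I (\<lambda>_. lborel))"
  shows "(\<integral>\<^sup>+w. f w \<partial>PiM I (\<lambda>_. lborel)) =
    ennreal (\<Prod>i\<in>I. \<bar>c i\<bar>) * (\<integral>\<^sup>+w. f (\<lambda>i\<in>I. c i * w i) \<partial>PiM I (\<lambda>_. lborel))"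
proof -
  let ?P = "PiM I (\<lambda>_::'i. lborel :: real measure)" and ?S = "\<lambda>w. \<lambda>i\<in>I. c i * w i"
  have S: "?S \<in> ?P \<rightarrow>\<^sub>M ?P" by measurable
  have "(\<integral>\<^sup>+w. f w \<partial>?P) =
      (\<integral>\<^sup>+w. f w \<partial>density (distr ?P ?P ?S) (\<lambda>_. ennreal (\<Prod>i\<in>I. \<bar>c i\<bar>)))"
    by (simp only: PiM_lborel_scale[of I c, OF I c])
  also have "\<dots> = ennreal (\<Prod>i\<in>I. \<bar>c i\<bar>) * (\<integral>\<^sup>+w. f (?S w) \<partial>?P)"
    using f S by (simp add: nn_integral_density nn_integral_cmult nn_integral_distr)
  finally show ?thesis .
qed

section \<open>The sphere in gnomonic coordinates\<close>

text \<open>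
  The gnomonic chart at the pole \<open>(\<sigma>r, 0)\<close>, \<open>\<sigma> = \<plusminus>1\<close>, is the central projection of the tangent
  hyperplane \<open>t\<^sub>k = \<sigma>r\<close> onto the sphere; \<open>gnomonic_scale\<close> is the factor by which the point of the
  hyperplane has to be shrunk. Tangent vectors are functions on \<open>-{k}\<close>, and their values at
  \<open>k\<close> are ignored.
\<close>

definition gnomonic_scale :: "'n::finite \<Rightarrow> real \<Rightarrow> ('n \<Rightarrow> real) \<Rightarrow> real" where
  "gnomonic_scale k r w = sqrt (1 + (\<Sum>i\<in>-{k}. (w i / r)\<^sup>2))"

definition gnomonic_point :: "'n::finite \<Rightarrow> real \<Rightarrow> real \<Rightarrow> ('n \<Rightarrow> real) \<Rightarrow> real ^ 'n" where
  "gnomonic_point k r \<sigma> w = (\<chi> i. (if i = k then \<sigma> * r else w i) / gnomonic_scale k r w)"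

lemma gnomonic_scale_ge_1: "gnomonic_scale k r w \<ge> 1"
  unfolding gnomonic_scale_def by (auto intro: sum_nonneg)

lemma gnomonic_scale_pos: "gnomonic_scale k r w > 0"
  using gnomonic_scale_ge_1[of k r w] by linarith

lemma gnomonic_scale_power2: "(gnomonic_scale k r w)\<^sup>2 = 1 + (\<Sum>i\<in>-{k}. (w i / r)\<^sup>2)"
  unfolding gnomonic_scale_def by (subst real_sqrt_pow2) (auto intro!: add_nonneg_nonneg sum_nonneg)

lemma measurable_gnomonic_scale [measurable]:
  "gnomonic_scale k r \<in> borel_measurable (PiM (-{k}) (\<lambda>_. lborel))"
  unfolding gnomonic_scale_def[abs_def] by measurable

lemma measurable_gnomonic_point_pair [measurable]:
  "(\<lambda>(\<sigma>, w). gnomonic_point k r \<sigma> w) \<in> borel_measurable (borel \<Otimes>\<^sub>M PiM (-{k}) (\<lambda>_. lborel))"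
proof -
  have [measurable]: "(\<lambda>x. if i = k then fst x * r else snd x i) \<in>
      borel_measurable (borel \<Otimes>\<^sub>M PiM (-{k}) (\<lambda>_. lborel))" for i
    by (cases "i = k") auto
  show ?thesis
    unfolding gnomonic_point_def split_beta by measurable
qed

lemma measurable_gnomonic_point [measurable]:
  "gnomonic_point k r \<sigma> \<in> borel_measurable (PiM (-{k}) (\<lambda>_. lborel))"
proof -
  have "Pair \<sigma> \<in> PiM (-{k}) (\<lambda>_. lborel) \<rightarrow>\<^sub>M borel \<Otimes>\<^sub>M PiM (-{k}) (\<lambda>_. lborel)"
    by simp
  from measurable_compose[OF this measurable_gnomonic_point_pair] show ?thesis by simp
qed

lemma norm_gnomonic_point:
  assumes "r > 0" "\<bar>\<sigma>\<bar> = 1"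
  shows "norm (gnomonic_point k r \<sigma> w) = r"
proof -
  let ?s = "gnomonic_scale k r w"
  have s2: "\<sigma>\<^sup>2 = 1" using assms(2) by (metis power2_abs one_power2)
  have "(norm (gnomonic_point k r \<sigma> w))\<^sup>2 =
      (\<Sum>i\<in>UNIV. ((if i = k then \<sigma> * r else w i) / ?s)\<^sup>2)"
    by (simp add: norm_vec_def L2_set_def gnomonic_point_def sum_nonneg flip: abs_divide)
  also have "\<dots> = (\<sigma> * r / ?s)\<^sup>2 + (\<Sum>i\<in>-{k}. (w i / ?s)\<^sup>2)"
    by (subst sum.remove[of _ k]) (auto simp: Compl_eq_Diff_UNIV intro!: sum.cong)
  also have "\<dots> = (r\<^sup>2 + (\<Sum>i\<in>-{k}. (w i)\<^sup>2)) / ?s\<^sup>2"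
    by (simp add: power_mult_distrib power_divide s2 add_divide_distrib flip: sum_divide_distrib)
  also have "r\<^sup>2 + (\<Sum>i\<in>-{k}. (w i)\<^sup>2) = r\<^sup>2 * ?s\<^sup>2"
    using assms(1) by (simp add: gnomonic_scale_power2 power_divide distrib_left sum_distrib_left)
  also have "r\<^sup>2 * ?s\<^sup>2 / ?s\<^sup>2 = r\<^sup>2"
    using gnomonic_scale_pos[of k r w] by simp
  finally show ?thesis
    using assms(1) by (simp add: power2_eq_iff_nonneg)
qed

lemma nn_integral_sphere_measure:
  fixes F :: "'a::euclidean_space \<Rightarrow> ennreal"
  assumes r: "r > 0" and [measurable]: "F \<in> borel_measurable borel"
  shows "(\<integral>\<^sup>+t. F t \<partial>sphere_measure r) = ennreal (real DIM('a) / r) *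
    (\<integral>\<^sup>+x. F ((r / norm x) *\<^sub>R x) * indicator (cball 0 r - {0}) x \<partial>lborel)"
proof -
  note [measurable] = radial_projection_measurable[OF r, where 'a='a]
  have [measurable]: "F \<in> borel_measurable (restrict_space borel (sphere 0 r))"
    by (rule measurable_restrict_space1) simp
  show ?thesis
    unfolding sphere_measure_def
    by (simp add: nn_integral_density nn_integral_cmult nn_integral_distr nn_integral_restrict_space)
qed

text \<open>
  The height integral of the cone: \<open>\<bar>y\<bar> / r\<close> is the scaling factor of the slice at height \<open>y\<close>, so its
  \<open>(n - 1)\<close>-dimensional volume carries the power \<open>n - 1\<close>.
\<close>

lemma nn_integral_power_Icc:
  assumes r: "r > 0" and a: "a \<ge> 0" and n: "n > 0"
  shows "(\<integral>\<^sup>+y. ennreal ((\<bar>y\<bar> / r) ^ (n - 1)) * indicator {0..a} y \<partial>lborel) =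
    ennreal (r / real n * (a / r) ^ n)"
proof -
  have "(\<integral>\<^sup>+y. ennreal ((\<bar>y\<bar> / r) ^ (n - 1)) * indicator {0..a} y \<partial>lborel) =
      (\<integral>\<^sup>+y. ennreal ((y / r) ^ (n - 1)) * indicator {0..a} y \<partial>lborel)"
    by (intro nn_integral_cong) (auto simp: indicator_def)
  also have "\<dots> = r / real n * (a / r) ^ n - r / real n * (0 / r) ^ n"
  proof (rule nn_integral_FTC_Icc)
    show "((\<lambda>y. r / real n * (y / r) ^ n) has_real_derivative (x / r) ^ (n - 1)) (at x)"
      for x using r n by (auto intro!: derivative_eq_intros)
  qed (use r a in auto)
  finally show ?thesis using n by (simp add: power_0_left)
qed

text \<open>
  The surface integral is an integral over a ball of a function \<open>H\<close> that is constant along rays. On the slice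
  \<open>x\<^sub>k = y\<close> substitute \<open>\<bar>y\<bar> / r\<close> times \<open>v\<close> for the other coordinates: the ray through the resulting point
  is determined by \<open>v\<close> and the sign of \<open>y\<close>, and the point lies in the ball iff
  \<open>\<bar>y\<bar> \<le> r / s\<close>, with \<open>s\<close> the gnomonic scale of \<open>v\<close>. Integrating \<open>y\<close> first leaves the density
  \<open>s\<^sup>-\<^sup>d\<close>, and the two signs of \<open>y\<close> give the two hemispheres.
\<close>

lemma nn_integral_sphere_gnomonic:
  fixes k :: "'n::finite" and F :: "real ^ 'n \<Rightarrow> ennreal"
  assumes r: "r > 0" and [measurable]: "F \<in> borel_measurable borel"
  shows "(\<integral>\<^sup>+t. F t \<partial>sphere_measure r) =
    (\<integral>\<^sup>+w. ennreal (1 / gnomonic_scale k r w ^ CARD('n)) *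
        (F (gnomonic_point k r 1 w) + F (gnomonic_point k r (-1) w)) \<partial>PiM (-{k}) (\<lambda>_. lborel))"
proof -
  let ?n = "CARD('n)" and ?P = "PiM (-{k}) (\<lambda>_. lborel :: real measure)"
  let ?s = "gnomonic_scale k r" and ?p = "gnomonic_point k r"
  have n: "?n > 0" by simp
  have card: "card (-{k}) = ?n - 1" by (simp add: Compl_eq_Diff_UNIV)
  interpret P: sigma_finite_measure ?P by (rule lborel_product.sigma_finite) simp
  interpret PS: pair_sigma_finite ?P "lborel :: real measure" ..
  define H where "H x = F ((r / norm x) *\<^sub>R x) * indicator (cball 0 r - {0}) x" for x
  have [measurable]: "cball 0 r - {0 :: real ^ 'n} \<in> sets borel" by simp
  have [measurable]: "H \<in> borel_measurable borel" unfolding H_def by measurable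
  define G where "G v y = ennreal ((\<bar>y\<bar> / r) ^ (?n - 1)) *
      (F (?p (sgn y) v) * indicator {- (r / ?s v)..r / ?s v} y)" for v y
  have [measurable]: "(\<lambda>(v, y). G v y) \<in> borel_measurable (?P \<Otimes>\<^sub>M lborel)"
  proof -
    have [measurable]: "(\<lambda>x. ?p (sgn (snd x)) (fst x)) \<in> borel_measurable (?P \<Otimes>\<^sub>M (lborel :: real measure))"
      using measurable_compose[OF _ measurable_gnomonic_point_pair[of k r],
        of "\<lambda>x. (sgn (snd x), fst x)" "?P \<Otimes>\<^sub>M (lborel :: real measure)"] by simp
    show ?thesis unfolding G_def indicator_def split_beta atLeastAtMost_iff by measurable
  qed
  \<comment> \<open>The slice \<open>y = 0\<close> has to be left out below: there the substitution degenerates.\<close>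
  have "(\<integral>\<^sup>+x. H x \<partial>lborel) = (\<integral>\<^sup>+f. H (\<chi> i. f i) \<partial>PiM (insert k (-{k})) (\<lambda>_. lborel))"
    by (subst lborel_vec_eq_distr_PiM) (simp add: nn_integral_distr insert_UNIV Compl_eq_Diff_UNIV insert_absorb)
  also have "\<dots> = (\<integral>\<^sup>+y. (\<integral>\<^sup>+w. H (\<chi> i. (w(k := y)) i) \<partial>?P) \<partial>lborel)"
    by (subst lborel_product.product_nn_integral_insert_rev) auto
  also have "\<dots> = (\<integral>\<^sup>+y. (\<integral>\<^sup>+v. G v y \<partial>?P) \<partial>lborel)"
  proof (rule nn_integral_cong_AE, rule AE_mp[OF AE_lborel_singleton[of 0]], rule AE_I2, rule impI)
    fix y :: real assume y: "y \<noteq> 0"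
    let ?u = "\<lambda>v. \<chi> i. ((\<lambda>i\<in>-{k}. \<bar>y\<bar> / r * v i)(k := y)) i"
    have H_eq: "H (?u v) = F (?p (sgn y) v) * indicator {- (r / ?s v)..r / ?s v} y" for v
    proof -
      have sp: "?s v > 0" by (rule gnomonic_scale_pos)
      have np: "norm (?p (sgn y) v) = r"
        by (rule norm_gnomonic_point) (use r y in \<open>auto simp: sgn_if\<close>)
      have u: "?u v = (\<bar>y\<bar> * ?s v / r) *\<^sub>R ?p (sgn y) v"
        using r sp by (simp add: vec_eq_iff gnomonic_point_def abs_mult_sgn field_simps)
      have nu: "norm (?u v) = \<bar>y\<bar> * ?s v"
        unfolding u using np r sp by simp
      have "(r / norm (?u v)) *\<^sub>R ?u v = ?p (sgn y) v"
        unfolding nu unfolding u using r sp y by simp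
      moreover have "?u v \<noteq> 0" using nu sp y by auto
      moreover have "norm (?u v) \<le> r \<longleftrightarrow> y \<in> {- (r / ?s v)..r / ?s v}"
      proof -
        have "\<bar>y\<bar> * ?s v \<le> r \<longleftrightarrow> \<bar>y\<bar> \<le> r / ?s v" using sp by (simp add: pos_le_divide_eq)
        then show ?thesis unfolding nu by auto
      qed
      ultimately show ?thesis by (simp add: H_def indicator_def)
    qed
    have "(\<integral>\<^sup>+w. H (\<chi> i. (w(k := y)) i) \<partial>?P) =
        ennreal (\<Prod>i\<in>-{k}. \<bar>\<bar>y\<bar> / r\<bar>) * (\<integral>\<^sup>+v. H (?u v) \<partial>?P)"
    proof (rule nn_integral_PiM_lborel_scale)
      have "(\<lambda>w. if i = k then y else w i) \<in> borel_measurable ?P" for i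
        by (cases "i = k") auto
      then show "(\<lambda>w. H (\<chi> i. (w(k := y)) i)) \<in> borel_measurable ?P"
        unfolding fun_upd_apply by measurable
    qed (use r y in auto)
    also have "\<dots> = (\<integral>\<^sup>+v. G v y \<partial>?P)"
    proof -
      have "(\<lambda>v. F (?p (sgn y) v) * indicator {- (r / ?s v)..r / ?s v} y) \<in> borel_measurable ?P"
        unfolding indicator_def atLeastAtMost_iff by measurable
      then show ?thesis
        unfolding H_eq G_def using r by (subst nn_integral_cmult) (auto simp: card)
    qed
    finally show "(\<integral>\<^sup>+w. H (\<chi> i. (w(k := y)) i) \<partial>?P) = (\<integral>\<^sup>+v. G v y \<partial>?P)" .
  qed
  also have "\<dots> = (\<integral>\<^sup>+v. (\<integral>\<^sup>+y. G v y \<partial>lborel) \<partial>?P)"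
    by (rule PS.Fubini') measurable
  also have "\<dots> = (\<integral>\<^sup>+v. ennreal (r / real ?n) * (ennreal (1 / ?s v ^ ?n) *
      (F (?p 1 v) + F (?p (-1) v))) \<partial>?P)"
  proof (rule nn_integral_cong)
    fix v
    let ?a = "r / ?s v"
    have sp: "?s v > 0" by (rule gnomonic_scale_pos)
    have a: "?a \<ge> 0" using r sp by simp
    \<comment> \<open>Up to the null set \<open>{0}\<close>, the height integral splits into the parts \<open>y > 0\<close> and \<open>y < 0\<close>.\<close>
    define g where "g y = ennreal ((\<bar>y\<bar> / r) ^ (?n - 1)) * indicator {0..?a} y" for y
    have [measurable]: "g \<in> borel_measurable borel" unfolding g_def by measurable
    have g: "(\<integral>\<^sup>+y. g y \<partial>lborel) = ennreal (r / real ?n * (1 / ?s v ^ ?n))"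
      unfolding g_def using nn_integral_power_Icc[OF r a n] r by (simp add: power_divide)
    then have g': "(\<integral>\<^sup>+y. g (- y) \<partial>lborel) = ennreal (r / real ?n * (1 / ?s v ^ ?n))"
      by (subst (asm) nn_integral_real_affine[of _ "-1" 0]) auto
    have "(\<integral>\<^sup>+y. G v y \<partial>lborel) = (\<integral>\<^sup>+y. g y * F (?p 1 v) + g (- y) * F (?p (-1) v) \<partial>lborel)"
      by (rule nn_integral_cong_AE, rule AE_mp[OF AE_lborel_singleton[of 0]], rule AE_I2)
         (use a in \<open>auto simp: G_def g_def sgn_if indicator_def mult_ac\<close>)
    also have "\<dots> = ennreal (r / real ?n * (1 / ?s v ^ ?n)) * (F (?p 1 v) + F (?p (-1) v))"
      by (simp add: nn_integral_add nn_integral_multc g g' distrib_left)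
    also have "\<dots> = ennreal (r / real ?n) * (ennreal (1 / ?s v ^ ?n) * (F (?p 1 v) + F (?p (-1) v)))"
      using r sp by (subst ennreal_mult) (auto simp: mult.assoc)
    finally show "(\<integral>\<^sup>+y. G v y \<partial>lborel) =
        ennreal (r / real ?n) * (ennreal (1 / ?s v ^ ?n) * (F (?p 1 v) + F (?p (-1) v)))" .
  qed
  also have "\<dots> = ennreal (r / real ?n) * (\<integral>\<^sup>+v. ennreal (1 / ?s v ^ ?n) *
      (F (?p 1 v) + F (?p (-1) v)) \<partial>?P)"
    by (rule nn_integral_cmult) measurable
  finally have H: "(\<integral>\<^sup>+x. H x \<partial>lborel) = \<dots>" .
  have "ennreal (real ?n / r) * ennreal (r / real ?n) = 1"
    using r by (subst ennreal_mult[symmetric]) auto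
  then show ?thesis
    using nn_integral_sphere_measure[OF r, of F] H
    by (simp add: H_def mult.assoc[symmetric])
qed

lemma measurable_sphere_measure:
  "F \<in> borel_measurable borel \<Longrightarrow> F \<in> borel_measurable (sphere_measure r)"
  by (subst measurable_cong_sets[OF sets_sphere_measure refl]) (rule measurable_restrict_space1)

lemma finite_measure_sphere_measure:
  "r > 0 \<Longrightarrow> finite_measure (sphere_measure r :: 'a::euclidean_space measure)"
  by (rule finite_measureI) (simp add: emeasure_sphere_measure_space)

lemma integrable_sphere_continuous:
  fixes F :: "'a::euclidean_space \<Rightarrow> real"
  assumes r: "r > 0" and F: "continuous_on UNIV F"
  shows "integrable (sphere_measure r) F"
proof -
  interpret finite_measure "sphere_measure r :: 'a measure"
    by (rule finite_measure_sphere_measure[OF r])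
  have "compact (F ` sphere 0 r)"
    by (intro compact_continuous_image continuous_on_subset[OF F]) auto
  then obtain B where B: "\<And>x. x \<in> sphere 0 r \<Longrightarrow> \<bar>F x\<bar> \<le> B"
    using compact_imp_bounded[THEN bounded_iff[THEN iffD1]] by fastforce
  show ?thesis
    by (rule integrable_const_bound[of _ B])
       (use B F in \<open>auto intro!: measurable_sphere_measure borel_measurable_continuous_onI AE_I2\<close>)
qed

lemma integrable_gnomonic:
  fixes F :: "real ^ 'n::finite \<Rightarrow> real"
  assumes r: "r > 0" and [measurable]: "F \<in> borel_measurable borel"
    and int: "integrable (sphere_measure r) F" and \<sigma>: "\<sigma> \<in> {1, -1}"
  shows "integrable (PiM (-{k}) (\<lambda>_. lborel))
    (\<lambda>w. F (gnomonic_point k r \<sigma> w) / gnomonic_scale k r w ^ CARD('n))"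
proof (rule integrableI_bounded)
  let ?P = "PiM (-{k}) (\<lambda>_. lborel :: real measure)"
  let ?s = "gnomonic_scale k r" and ?p = "gnomonic_point k r"
  have "(\<integral>\<^sup>+w. ennreal (norm (F (?p \<sigma> w) / ?s w ^ CARD('n))) \<partial>?P) \<le>
      (\<integral>\<^sup>+w. ennreal (1 / ?s w ^ CARD('n)) *
        (ennreal (norm (F (?p 1 w))) + ennreal (norm (F (?p (-1) w)))) \<partial>?P)"
  proof (rule nn_integral_mono)
    fix w
    have sp: "?s w > 0" by (rule gnomonic_scale_pos)
    show "ennreal (norm (F (?p \<sigma> w) / ?s w ^ CARD('n))) \<le> ennreal (1 / ?s w ^ CARD('n)) *
        (ennreal (norm (F (?p 1 w))) + ennreal (norm (F (?p (-1) w))))"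
      using \<sigma> sp
      by (auto simp: abs_mult divide_right_mono simp flip: ennreal_plus ennreal_mult intro!: ennreal_leI)
  qed
  also have "\<dots> = (\<integral>\<^sup>+t. ennreal (norm (F t)) \<partial>sphere_measure r)"
    by (rule nn_integral_sphere_gnomonic[OF r, symmetric]) measurable
  also have "\<dots> < \<infinity>"
    using int by (simp add: integrable_iff_bounded)
  finally show "(\<integral>\<^sup>+w. ennreal (norm (F (?p \<sigma> w) / ?s w ^ CARD('n))) \<partial>?P) < \<infinity>" .
qed measurable

text \<open>
  The transfer to signed functions is by positive and negative parts: the formula for nonnegative functions
  bounds each of the two hemisphere integrals by the full one, so all parts are integrable.
\<close>

lemma integral_sphere_gnomonic:
  fixes F :: "real ^ 'n::finite \<Rightarrow> real"
  assumes r: "r > 0" and F [measurable]: "F \<in> borel_measurable borel"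
    and int: "integrable (sphere_measure r) F"
  shows "(LINT t|sphere_measure r. F t) =
    (LINT w|PiM (-{k}) (\<lambda>_. lborel). F (gnomonic_point k r 1 w) / gnomonic_scale k r w ^ CARD('n)) +
    (LINT w|PiM (-{k}) (\<lambda>_. lborel). F (gnomonic_point k r (-1) w) / gnomonic_scale k r w ^ CARD('n))"
proof -
  let ?P = "PiM (-{k}) (\<lambda>_. lborel :: real measure)"
  let ?s = "gnomonic_scale k r" and ?p = "gnomonic_point k r"
  define I where "I G \<sigma> = (LINT w|?P. G (?p \<sigma> w) / ?s w ^ CARD('n))" for G :: "real ^ 'n \<Rightarrow> real" and \<sigma>
  have nonneg: "(LINT t|sphere_measure r. G t) = I G 1 + I G (-1)"
    if [measurable]: "G \<in> borel_measurable borel" and G: "integrable (sphere_measure r) G" "\<And>t. G t \<ge> 0" for G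
  proof -
    have J: "ennreal (I G \<sigma>) = (\<integral>\<^sup>+w. ennreal (G (?p \<sigma> w) / ?s w ^ CARD('n)) \<partial>?P)" "I G \<sigma> \<ge> 0"
      if "\<sigma> \<in> {1, -1}" for \<sigma>
      unfolding I_def using integrable_gnomonic[OF r _ G(1) that] G(2)
      by (auto intro!: nn_integral_eq_integral[symmetric] integral_nonneg_AE
            simp: gnomonic_scale_pos less_imp_le)
    have "ennreal (LINT t|sphere_measure r. G t) = (\<integral>\<^sup>+t. ennreal (G t) \<partial>sphere_measure r)"
      using G by (auto intro!: nn_integral_eq_integral[symmetric])
    also have "\<dots> = (\<integral>\<^sup>+w. ennreal (1 / ?s w ^ CARD('n)) * (ennreal (G (?p 1 w)) + ennreal (G (?p (-1) w))) \<partial>?P)"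
      by (rule nn_integral_sphere_gnomonic[OF r]) measurable
    also have "\<dots> = (\<integral>\<^sup>+w. ennreal (G (?p 1 w) / ?s w ^ CARD('n)) + ennreal (G (?p (-1) w) / ?s w ^ CARD('n)) \<partial>?P)"
      using gnomonic_scale_pos[of k r] G(2)
      by (intro nn_integral_cong)
         (simp add: distrib_left less_imp_le add_divide_distrib flip: ennreal_plus ennreal_mult)
    also have "\<dots> = ennreal (I G 1) + ennreal (I G (-1))"
      by (subst nn_integral_add) (auto simp: J)
    also have "\<dots> = ennreal (I G 1 + I G (-1))"
      using J by simp
    finally show ?thesis
      using J G by (subst (asm) ennreal_inj) (auto intro!: integral_nonneg_AE)
  qed
  let ?F1 = "\<lambda>t. max 0 (F t)" and ?F2 = "\<lambda>t. max 0 (- F t)"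
  have int': "integrable (sphere_measure r) ?F1" "integrable (sphere_measure r) ?F2"
    using int by (auto intro!: integrable_max)
  have F_eq: "F t = ?F1 t - ?F2 t" for t by auto
  have I_eq: "I F \<sigma> = I ?F1 \<sigma> - I ?F2 \<sigma>" if "\<sigma> \<in> {1, -1}" for \<sigma>
    unfolding I_def
    by (subst Bochner_Integration.integral_diff[symmetric])
       (auto simp flip: diff_divide_distrib F_eq intro!: integrable_gnomonic[OF r _ _ that] int')
  have "(LINT t|sphere_measure r. F t) = (LINT t|sphere_measure r. ?F1 t) - (LINT t|sphere_measure r. ?F2 t)"
    by (subst Bochner_Integration.integral_diff[symmetric, OF int']) (simp flip: F_eq)
  also have "\<dots> = I F 1 + I F (-1)"
    by (simp add: nonneg int' I_eq)
  finally show ?thesis unfolding I_def .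
qed

section \<open>Derivatives of the Fisher-Bingham integral\<close>

lemma abs_exp_minus_linear_le: "\<bar>exp y - 1 - y\<bar> \<le> exp \<bar>y\<bar> * y\<^sup>2" for y :: real
proof -
  obtain t where t: "\<bar>t\<bar> \<le> \<bar>y\<bar>" "exp y = (\<Sum>m<2. y ^ m / fact m) + exp t / fact 2 * y ^ 2"
    using Maclaurin_exp_le[of y 2] by blast
  have "exp y - 1 - y = exp t / 2 * y\<^sup>2"
    using t(2) by (simp add: numeral_2_eq_2)
  moreover have "exp t / 2 \<le> exp \<bar>y\<bar>"
    using t(1) exp_le_cancel_iff[of t "\<bar>y\<bar>"] exp_gt_zero[of t] exp_gt_zero[of "\<bar>y\<bar>"]
    by linarith
  ultimately have "\<bar>exp y - 1 - y\<bar> = exp t / 2 * y\<^sup>2" "exp t / 2 * y\<^sup>2 \<le> exp \<bar>y\<bar> * y\<^sup>2"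
    by (simp_all only: abs_mult abs_power2 mult_right_mono zero_le_power2) simp
  then show ?thesis by simp
qed

text \<open>
  With \<open>b\<close> and \<open>q\<close> bounded and the measure finite, the second-order Taylor bound for the exponential is
  uniform in the integration variable, so the difference quotient is within \<open>\<bar>h\<bar> C\<close> of the
  claimed derivative for \<open>\<bar>h\<bar> \<le> 1\<close>.
\<close>

lemma has_real_derivative_integral_exp:
  fixes q b :: "'a \<Rightarrow> real"
  assumes fin: "finite_measure M"
    and [measurable]: "q \<in> borel_measurable M" "b \<in> borel_measurable M"
    and Q: "\<And>x. x \<in> space M \<Longrightarrow> \<bar>q x\<bar> \<le> Q" and B: "\<And>x. x \<in> space M \<Longrightarrow> \<bar>b x\<bar> \<le> B"
  shows "((\<lambda>h. LINT x|M. exp (q x + h * b x)) has_real_derivative (LINT x|M. b x * exp (q x))) (at 0)"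
proof -
  interpret finite_measure M by fact
  define f where "f h = (LINT x|M. exp (q x + h * b x))" for h
  define D where "D = (LINT x|M. b x * exp (q x))"
  define C where "C = exp Q * exp B * B\<^sup>2 * measure M (space M)"
  have hb: "\<bar>h * b x\<bar> \<le> B" "(h * b x)\<^sup>2 \<le> h\<^sup>2 * B\<^sup>2" if "x \<in> space M" "\<bar>h\<bar> \<le> 1" for h x
  proof -
    have "\<bar>h\<bar> * \<bar>b x\<bar> \<le> 1 * B"
      using B[OF that(1)] that(2) by (intro mult_mono) auto
    then show "\<bar>h * b x\<bar> \<le> B" by (simp add: abs_mult)
    show "(h * b x)\<^sup>2 \<le> h\<^sup>2 * B\<^sup>2"
      using B[OF that(1)] by (auto simp: power_mult_distrib intro!: mult_left_mono power2_le_iff_abs_le[THEN iffD2])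
  qed
  have int_exp: "integrable M (\<lambda>x. exp (q x + h * b x))" if "\<bar>h\<bar> \<le> 1" for h
    by (rule integrable_const_bound[of _ "exp (Q + B)"])
       (use Q hb that in \<open>fastforce intro!: AE_I2\<close>)+
  have int_D: "integrable M (\<lambda>x. b x * exp (q x))"
    by (rule integrable_const_bound[of _ "B * exp Q"])
       (use Q B in \<open>fastforce intro!: AE_I2 mult_mono simp: abs_mult\<close>)+
  have le: "\<bar>(f h - f 0) / h - D\<bar> \<le> \<bar>h\<bar> * C" if h: "h \<noteq> 0" "\<bar>h\<bar> \<le> 1" for h
  proof -
    have "f h - f 0 - h * D = (LINT x|M. exp (q x) * (exp (h * b x) - 1 - h * b x))"
      using int_exp[of h] int_exp[of 0] int_D h unfolding f_def D_def
      by (simp add: exp_add algebra_simps)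
    also have "\<bar>\<dots>\<bar> \<le> (LINT x|M. \<bar>exp (q x) * (exp (h * b x) - 1 - h * b x)\<bar>)"
      by (rule integral_abs_bound)
    also have "\<dots> \<le> (LINT x|M. exp Q * (exp B * (h\<^sup>2 * B\<^sup>2)))"
    proof (rule integral_mono)
      fix x assume x: "x \<in> space M"
      show "\<bar>exp (q x) * (exp (h * b x) - 1 - h * b x)\<bar> \<le> exp Q * (exp B * (h\<^sup>2 * B\<^sup>2))"
        unfolding abs_mult
        using Q[OF x] hb[OF x h(2)]
        by (intro mult_mono order_trans[OF abs_exp_minus_linear_le]) auto
    next
      have "integrable M (\<lambda>x. exp (q x + h * b x) - exp (q x + 0 * b x) - h * (b x * exp (q x)))"
        using int_exp[of h] int_exp[of 0] int_D h by (intro Bochner_Integration.integrable_diff integrable_mult_right) auto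
      then show "integrable M (\<lambda>x. \<bar>exp (q x) * (exp (h * b x) - 1 - h * b x)\<bar>)"
        by (intro integrable_abs) (simp add: exp_add algebra_simps)
    qed simp
    also have "\<dots> = \<bar>h\<bar>\<^sup>2 * C" by (simp add: C_def)
    finally have *: "\<bar>f h - f 0 - h * D\<bar> \<le> \<bar>h\<bar>\<^sup>2 * C" .
    have "\<bar>(f h - f 0) / h - D\<bar> = \<bar>f h - f 0 - h * D\<bar> / \<bar>h\<bar>"
      using h by (simp add: field_simps flip: abs_divide)
    also have "\<dots> \<le> \<bar>h\<bar>\<^sup>2 * C / \<bar>h\<bar>"
      using * by (intro divide_right_mono) auto
    also have "\<dots> = \<bar>h\<bar> * C" using h by (simp add: power2_eq_square del: abs_mult_self_eq)
    finally show ?thesis .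
  qed
  have "((\<lambda>h. (f h - f 0) / h - D) \<longlongrightarrow> 0) (at 0)"
  proof (rule Lim_null_comparison)
    show "\<forall>\<^sub>F h in at 0. norm ((f h - f 0) / h - D) \<le> \<bar>h\<bar> * C"
      unfolding eventually_at by (rule exI[of _ 1]) (auto intro!: le)
    show "((\<lambda>h. \<bar>h\<bar> * C) \<longlongrightarrow> 0) (at 0)"
      by (auto intro!: tendsto_eq_intros)
  qed
  then have "(f has_real_derivative D) (at 0)"
    by (simp add: has_field_derivative_iff LIM_zero_iff)
  then show ?thesis by (simp add: f_def[abs_def] D_def)
qed

definition fisher_bingham_exponent :: "real ^ 'n::finite \<Rightarrow> real ^ 'n \<Rightarrow> real ^ 'n \<Rightarrow> real" where
  "fisher_bingham_exponent lam tau t = (\<Sum>i\<in>UNIV. lam $ i * (t $ i)\<^sup>2) + (\<Sum>i\<in>UNIV. tau $ i * t $ i)"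

lemma continuous_on_fisher_bingham_exponent [continuous_intros]:
  "continuous_on S (fisher_bingham_exponent lam tau)"
  unfolding fisher_bingham_exponent_def[abs_def] by (intro continuous_intros)

text \<open>
  The exponent is affine in each parameter; the slope is the moment that appears in the derivative.
\<close>

lemma fisher_bingham_exponent_shift_lam:
  "fisher_bingham_exponent (lam + h *\<^sub>R axis j 1) tau t =
    fisher_bingham_exponent lam tau t + h * (t $ j)\<^sup>2"
proof -
  have "(\<Sum>i\<in>UNIV. axis j 1 $ i * (t $ i)\<^sup>2) = (\<Sum>i\<in>UNIV. if i = j then (t $ i)\<^sup>2 else 0)"
    by (intro sum.cong) (auto simp: axis_def)
  then show ?thesis
    by (simp add: fisher_bingham_exponent_def distrib_right sum.distrib mult.assoc
        flip: sum_distrib_left)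
qed

lemma fisher_bingham_exponent_shift_tau:
  "fisher_bingham_exponent lam (tau + h *\<^sub>R axis j 1) t =
    fisher_bingham_exponent lam tau t + h * t $ j"
proof -
  have "(\<Sum>i\<in>UNIV. axis j 1 $ i * t $ i) = (\<Sum>i\<in>UNIV. if i = j then t $ i else 0)"
    by (intro sum.cong) (auto simp: axis_def)
  then show ?thesis
    by (simp add: fisher_bingham_exponent_def distrib_right sum.distrib mult.assoc
        flip: sum_distrib_left)
qed

lemma fisher_bingham_eq:
  "fisher_bingham lam tau r = (LINT t|sphere_measure r. exp (fisher_bingham_exponent lam tau t))"
  by (simp add: fisher_bingham_def fisher_bingham_exponent_def)

lemma has_real_derivative_integral_exp_sphere:
  fixes q b :: "'a::euclidean_space \<Rightarrow> real"
  assumes r: "r > 0" and q: "continuous_on UNIV q" and b: "continuous_on UNIV b"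
  shows "((\<lambda>h. LINT t|sphere_measure r. exp (q t + h * b t)) has_real_derivative
    (LINT t|sphere_measure r. b t * exp (q t))) (at 0)"
proof -
  have bdd: "\<exists>B. \<forall>x\<in>sphere 0 r. \<bar>g x\<bar> \<le> B" if "continuous_on UNIV g" for g :: "'a \<Rightarrow> real"
  proof -
    have "compact (g ` sphere 0 r)"
      by (intro compact_continuous_image continuous_on_subset[OF that]) auto
    then show ?thesis
      using compact_imp_bounded[THEN bounded_iff[THEN iffD1]] by fastforce
  qed
  obtain Q B where "\<And>x. x \<in> sphere 0 r \<Longrightarrow> \<bar>q x\<bar> \<le> Q" "\<And>x. x \<in> sphere 0 r \<Longrightarrow> \<bar>b x\<bar> \<le> B"
    using bdd[OF q] bdd[OF b] by blast
  then show ?thesis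
    by (intro has_real_derivative_integral_exp[where Q=Q and B=B] finite_measure_sphere_measure r
          measurable_sphere_measure borel_measurable_continuous_onI q b) auto
qed

lemma fisher_bingham_partial_lam:
  assumes r: "r > 0"
  shows "partially_differentiable j (\<lambda>l. fisher_bingham l tau r) lam"
    and "partial_deriv j (\<lambda>l. fisher_bingham l tau r) lam =
      (LINT t|sphere_measure r. (t $ j)\<^sup>2 * exp (fisher_bingham_exponent lam tau t))"
proof -
  have "((\<lambda>h. fisher_bingham (lam + h *\<^sub>R axis j 1) tau r) has_real_derivative
      (LINT t|sphere_measure r. (t $ j)\<^sup>2 * exp (fisher_bingham_exponent lam tau t))) (at 0)"
    unfolding fisher_bingham_eq fisher_bingham_exponent_shift_lam
    by (intro has_real_derivative_integral_exp_sphere r continuous_intros)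
  then show "partially_differentiable j (\<lambda>l. fisher_bingham l tau r) lam"
    "partial_deriv j (\<lambda>l. fisher_bingham l tau r) lam =
      (LINT t|sphere_measure r. (t $ j)\<^sup>2 * exp (fisher_bingham_exponent lam tau t))"
    by (auto simp: partially_differentiable_def partial_deriv_def real_differentiable_def
          intro: DERIV_imp_deriv)
qed

lemma fisher_bingham_partial_tau:
  assumes r: "r > 0"
  shows "partially_differentiable j (\<lambda>t. fisher_bingham lam t r) tau"
    and "partial_deriv j (\<lambda>t. fisher_bingham lam t r) tau =
      (LINT t|sphere_measure r. t $ j * exp (fisher_bingham_exponent lam tau t))"
proof -
  have "((\<lambda>h. fisher_bingham lam (tau + h *\<^sub>R axis j 1) r) has_real_derivative
      (LINT t|sphere_measure r. t $ j * exp (fisher_bingham_exponent lam tau t))) (at 0)"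
    unfolding fisher_bingham_eq fisher_bingham_exponent_shift_tau
    by (intro has_real_derivative_integral_exp_sphere r continuous_intros)
  then show "partially_differentiable j (\<lambda>t. fisher_bingham lam t r) tau"
    "partial_deriv j (\<lambda>t. fisher_bingham lam t r) tau =
      (LINT t|sphere_measure r. t $ j * exp (fisher_bingham_exponent lam tau t))"
    by (auto simp: partially_differentiable_def partial_deriv_def real_differentiable_def
          intro: DERIV_imp_deriv)
qed

section \<open>The limit of the hemisphere integrals\<close>

text \<open>
  The squared distance of the point with chart coordinate \<open>w\<close> from the axis through the poles.
\<close>

definition tangential_norm2 :: "'n::finite \<Rightarrow> real \<Rightarrow> ('n \<Rightarrow> real) \<Rightarrow> real" where
  "tangential_norm2 k r w = (\<Sum>i\<in>-{k}. (w i / gnomonic_scale k r w)\<^sup>2)"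

text \<open>
  What remains of the exponent, in the chart, after removal of its value \<open>r\<^sup>2 \<lambda>\<^sub>k + \<sigma> r \<tau>\<^sub>k\<close> at the pole.
\<close>

definition laplace_exponent ::
    "real ^ 'n::finite \<Rightarrow> real ^ 'n \<Rightarrow> 'n \<Rightarrow> real \<Rightarrow> real \<Rightarrow> ('n \<Rightarrow> real) \<Rightarrow> real" where
  "laplace_exponent lam tau k \<sigma> r w =
    (\<Sum>i\<in>-{k}. tau $ i * (w i / gnomonic_scale k r w) -
        (lam $ k - lam $ i) * (w i / gnomonic_scale k r w)\<^sup>2) +
    \<sigma> * tau $ k * (r / gnomonic_scale k r w - r)"

text \<open>
  The pointwise limit of \<open>laplace_exponent\<close> as \<open>r\<close> tends to infinity; it is the same at both poles.
\<close>

definition gaussian_exponent ::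
    "real ^ 'n::finite \<Rightarrow> real ^ 'n \<Rightarrow> 'n \<Rightarrow> ('n \<Rightarrow> real) \<Rightarrow> real" where
  "gaussian_exponent lam tau k w = (\<Sum>i\<in>-{k}. tau $ i * w i - (lam $ k - lam $ i) * (w i)\<^sup>2)"

lemma measurable_laplace_exponent [measurable]:
  "laplace_exponent lam tau k \<sigma> r \<in> borel_measurable (PiM (-{k}) (\<lambda>_. lborel))"
  unfolding laplace_exponent_def[abs_def] by measurable

lemma measurable_gaussian_exponent [measurable]:
  "gaussian_exponent lam tau k \<in> borel_measurable (PiM (-{k}) (\<lambda>_. lborel))"
  unfolding gaussian_exponent_def[abs_def] by measurable

lemma tangential_norm2_nonneg: "tangential_norm2 k r w \<ge> 0"
  unfolding tangential_norm2_def by (intro sum_nonneg) auto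

lemma tangential_norm2_mult_scale:
  "tangential_norm2 k r w * (gnomonic_scale k r w)\<^sup>2 = (\<Sum>i\<in>-{k}. (w i)\<^sup>2)"
  using gnomonic_scale_pos[of k r w]
  by (simp add: tangential_norm2_def sum_distrib_right power_divide)

lemma tangential_norm2_eq:
  assumes "r > 0"
  shows "tangential_norm2 k r w = r\<^sup>2 * (1 - 1 / (gnomonic_scale k r w)\<^sup>2)"
proof -
  let ?s = "gnomonic_scale k r w"
  have sp: "?s > 0" by (rule gnomonic_scale_pos)
  have "r\<^sup>2 * (?s\<^sup>2 - 1) = (\<Sum>i\<in>-{k}. (w i)\<^sup>2)"
    using assms by (simp add: gnomonic_scale_power2 power_divide sum_distrib_left)
  also note tangential_norm2_mult_scale[symmetric]
  finally show ?thesis using sp by (simp add: field_simps)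
qed

text \<open>
  The height below the tangent plane at the pole, \<open>r - r/s = r (1 - 1/s)\<close>, is at most
  \<open>r (1 - 1/s\<^sup>2)\<close> because \<open>s \<ge> 1\<close>, and the latter is the squared distance from the axis divided by
  \<open>r\<close>. So the term \<open>\<sigma> \<tau>\<^sub>k (r/s - r)\<close> is, for large \<open>r\<close>, absorbed by the quadratic terms.
\<close>

lemma radial_defect_le:
  assumes r: "r > 0"
  shows "\<bar>r / gnomonic_scale k r w - r\<bar> \<le> tangential_norm2 k r w / r"
proof -
  let ?u = "1 / gnomonic_scale k r w"
  have u: "0 \<le> ?u" "?u \<le> 1"
    using gnomonic_scale_ge_1[of k r w] by auto
  then have "?u * ?u \<le> ?u * 1" by (intro mult_left_mono)
  then have "?u\<^sup>2 \<le> ?u" by (simp add: power2_eq_square)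
  then have "r * (1 - ?u) \<le> r * (1 - ?u\<^sup>2)" using r by simp
  moreover have "tangential_norm2 k r w / r = r * (1 - ?u\<^sup>2)"
    unfolding tangential_norm2_eq[OF r] using r by (simp add: power2_eq_square)
  moreover have "\<bar>r / gnomonic_scale k r w - r\<bar> = r * (1 - ?u)"
    using u r gnomonic_scale_ge_1[of k r w] gnomonic_scale_pos[of k r w]
    by (simp add: field_simps)
  ultimately show ?thesis by simp
qed

text \<open>
  The sphere equation replaces \<open>t\<^sub>k\<^sup>2\<close> by \<open>r\<^sup>2\<close> minus the other squares.
\<close>

lemma fisher_bingham_exponent_gnomonic:
  assumes r: "r > 0" and \<sigma>: "\<bar>\<sigma>\<bar> = 1"
  shows "fisher_bingham_exponent lam tau (gnomonic_point k r \<sigma> w) =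
    r\<^sup>2 * lam $ k + \<sigma> * (r * tau $ k) + laplace_exponent lam tau k \<sigma> r w"
proof -
  let ?s = "gnomonic_scale k r w" and ?p = "gnomonic_point k r \<sigma> w"
  have pk: "?p $ k = \<sigma> * r / ?s"
    by (simp add: gnomonic_point_def)
  have p: "(\<Sum>i\<in>-{k}. h i (?p $ i)) = (\<Sum>i\<in>-{k}. h i (w i / ?s))" for h :: "'a \<Rightarrow> real \<Rightarrow> real"
    by (intro sum.cong) (auto simp: gnomonic_point_def)
  have \<sigma>2: "\<sigma>\<^sup>2 = 1" using \<sigma> by (metis power2_abs one_power2)
  have split: "(\<Sum>i\<in>UNIV. h i) = h k + (\<Sum>i\<in>-{k}. h i)" for h :: "'a \<Rightarrow> real"
    by (subst sum.remove[of _ k]) (auto simp: Compl_eq_Diff_UNIV)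
  have "r\<^sup>2 / ?s\<^sup>2 = r\<^sup>2 - tangential_norm2 k r w"
    by (simp add: tangential_norm2_eq[OF r] algebra_simps)
  moreover have "(\<Sum>i\<in>-{k}. lam $ i * (w i / ?s)\<^sup>2) =
      lam $ k * tangential_norm2 k r w - (\<Sum>i\<in>-{k}. (lam $ k - lam $ i) * (w i / ?s)\<^sup>2)"
    by (simp add: tangential_norm2_def left_diff_distrib sum_subtractf sum_distrib_left)
  ultimately have "(\<Sum>i\<in>UNIV. lam $ i * (?p $ i)\<^sup>2) =
      r\<^sup>2 * lam $ k - (\<Sum>i\<in>-{k}. (lam $ k - lam $ i) * (w i / ?s)\<^sup>2)"
    unfolding split p[of "\<lambda>i x. lam $ i * x\<^sup>2"] pk
    by (simp add: \<sigma>2 power_mult_distrib power_divide) (simp add: algebra_simps)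
  moreover have "(\<Sum>i\<in>UNIV. tau $ i * ?p $ i) =
      \<sigma> * (r * tau $ k) + \<sigma> * tau $ k * (r / ?s - r) + (\<Sum>i\<in>-{k}. tau $ i * (w i / ?s))"
    unfolding split p[of "\<lambda>i x. tau $ i * x"] pk by (simp add: algebra_simps)
  ultimately show ?thesis
    by (simp add: fisher_bingham_exponent_def laplace_exponent_def sum_subtractf)
qed

text \<open>
  This is \<open>x \<le> exp x\<close> at \<open>x = c z / m\<close>, raised to the power \<open>m\<close>.
\<close>

lemma power_mult_exp_minus_le:
  fixes c z :: real
  assumes c: "c > 0" and z: "z \<ge> 0" and m: "m > 0"
  shows "z ^ m * exp (- (c * z)) \<le> (real m / c) ^ m"
proof -
  have "c * z / real m \<le> exp (c * z / real m)"
    using exp_ge_add_one_self[of "c * z / real m"] by linarith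
  then have "(c * z / real m) ^ m \<le> exp (c * z / real m) ^ m"
    using c z by (intro power_mono) auto
  also have "\<dots> = exp (c * z)"
    using m by (simp flip: exp_of_nat_mult)
  finally have "(c / real m) ^ m * z ^ m \<le> exp (c * z)"
    by (simp add: power_mult_distrib power_divide)
  then show ?thesis
    using c m by (simp add: exp_minus field_simps power_divide)
qed

text \<open>
  Of the quadratic decay rate \<open>c\<close>, one quarter pays for the linear terms (completing the square) and
  one quarter for the term with \<open>\<tau>\<^sub>k\<close>, once \<open>r\<close> is so large that \<open>\<bar>\<tau>\<^sub>k\<bar> / r \<le> c / 4\<close>. The
  remaining half is the claimed decay.
\<close>

lemma laplace_exponent_le:
  assumes r: "r > 0" and \<sigma>: "\<bar>\<sigma>\<bar> = 1" and c: "c > 0"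
    and gap: "\<And>i. i \<noteq> k \<Longrightarrow> c \<le> lam $ k - lam $ i" and rc: "4 * \<bar>tau $ k\<bar> \<le> c * r"
  shows "laplace_exponent lam tau k \<sigma> r w \<le>
    (\<Sum>i\<in>-{k}. (tau $ i)\<^sup>2 / c) - c / 2 * tangential_norm2 k r w"
proof -
  let ?s = "gnomonic_scale k r w" and ?y = "tangential_norm2 k r w"
  have "tau $ i * v - (lam $ k - lam $ i) * v\<^sup>2 \<le> (tau $ i)\<^sup>2 / c - 3 / 4 * c * v\<^sup>2"
    if "i \<in> -{k}" for i v
  proof -
    have "0 \<le> (tau $ i - c / 2 * v)\<^sup>2 / c" using c by simp
    also have "\<dots> = (tau $ i)\<^sup>2 / c - tau $ i * v + c / 4 * v\<^sup>2"
      using c by (simp add: power2_eq_square field_simps)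
    finally have "tau $ i * v \<le> (tau $ i)\<^sup>2 / c + c / 4 * v\<^sup>2" by simp
    moreover have "c * v\<^sup>2 \<le> (lam $ k - lam $ i) * v\<^sup>2"
      using gap that by (intro mult_right_mono) auto
    ultimately show ?thesis by linarith
  qed
  then have "(\<Sum>i\<in>-{k}. tau $ i * (w i / ?s) - (lam $ k - lam $ i) * (w i / ?s)\<^sup>2) \<le>
      (\<Sum>i\<in>-{k}. (tau $ i)\<^sup>2 / c - 3 / 4 * c * (w i / ?s)\<^sup>2)"
    by (rule sum_mono)
  also have "\<dots> = (\<Sum>i\<in>-{k}. (tau $ i)\<^sup>2 / c) - 3 / 4 * c * ?y"
    by (simp add: sum_subtractf tangential_norm2_def sum_distrib_left)
  moreover have "\<sigma> * tau $ k * (r / ?s - r) \<le> c / 4 * ?y"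
  proof -
    have "\<sigma> * tau $ k * (r / ?s - r) \<le> \<bar>tau $ k\<bar> * \<bar>r / ?s - r\<bar>"
      using abs_ge_self[of "\<sigma> * tau $ k * (r / ?s - r)"] \<sigma> by (simp add: abs_mult)
    also have "\<dots> \<le> \<bar>tau $ k\<bar> * (?y / r)"
      by (intro mult_left_mono radial_defect_le r) auto
    also have "\<dots> = \<bar>tau $ k\<bar> / r * ?y" by simp
    also have "\<dots> \<le> c / 4 * ?y"
      using r rc by (intro mult_right_mono tangential_norm2_nonneg) (simp add: field_simps)
    finally show ?thesis .
  qed
  ultimately show ?thesis unfolding laplace_exponent_def by linarith
qed

text \<open>
  With \<open>y\<^sup>2\<close> the tangential norm, \<open>y\<^sup>2 s\<^sup>2 = \<bar>w\<bar>\<^sup>2\<close>, so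
  \<open>(1 + y\<^sup>2) s\<^sup>2 = s\<^sup>2 + \<bar>w\<bar>\<^sup>2 \<ge> 1 + \<bar>w\<bar>\<^sup>2\<close>. This is how the density \<open>s\<^sup>-\<^sup>d\<close>, which depends on
  \<open>r\<close>, is compared with the one on the unit sphere.
\<close>

lemma gnomonic_scale_1_le:
  assumes "r > 0"
  shows "gnomonic_scale k 1 w \<le> sqrt (1 + tangential_norm2 k r w) * gnomonic_scale k r w"
proof -
  let ?s = "gnomonic_scale k r w"
  have "(gnomonic_scale k 1 w)\<^sup>2 \<le> ?s\<^sup>2 + tangential_norm2 k r w * ?s\<^sup>2"
    unfolding tangential_norm2_mult_scale
    by (simp add: gnomonic_scale_power2 sum_nonneg)
  also have "\<dots> = (sqrt (1 + tangential_norm2 k r w) * ?s)\<^sup>2"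
    by (simp add: power_mult_distrib distrib_right tangential_norm2_nonneg)
  finally show ?thesis
    by (rule power2_le_imp_le) (simp add: tangential_norm2_nonneg gnomonic_scale_pos less_imp_le)
qed

text \<open>
  The exponential decays only in \<open>y = \<bar>w\<bar> / s\<close>, which stays below \<open>r\<close>, and the density \<open>s\<^sup>-\<^sup>n\<close> decays
  only once \<open>\<bar>w\<bar>\<close> exceeds \<open>r\<close>. Together they suffice: by \<open>gnomonic_scale_1_le\<close> a power of
  \<open>1 + y\<^sup>2\<close> turns \<open>s\<^sup>-\<^sup>n\<close> into \<open>(1 + \<bar>w\<bar>\<^sup>2)\<^bsup>-n/2\<^esup>\<close>, and the exponential beats every such power. The
  allowance \<open>1 + y\<^sup>2\<close> for \<open>g\<close> covers the first and second moments of the tangential coordinates.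
\<close>

lemma laplace_dominated:
  assumes r: "r > 0" and \<sigma>: "\<bar>\<sigma>\<bar> = 1" and c: "c > 0"
    and gap: "\<And>i. i \<noteq> k \<Longrightarrow> c \<le> lam $ k - lam $ i" and rc: "4 * \<bar>tau $ k\<bar> \<le> c * r"
    and g: "\<bar>g\<bar> \<le> 1 + tangential_norm2 k r w"
  shows "\<bar>g * exp (laplace_exponent lam tau k \<sigma> r w) / gnomonic_scale k r w ^ n\<bar> \<le>
    exp ((\<Sum>i\<in>-{k}. (tau $ i)\<^sup>2 / c) + c / 2) * (real (n + 1) / (c / 2)) ^ (n + 1) *
      (1 / gnomonic_scale k 1 w ^ n)"
proof -
  let ?s = "gnomonic_scale k r w" and ?s1 = "gnomonic_scale k 1 w"
  let ?z = "1 + tangential_norm2 k r w" and ?K = "\<Sum>i\<in>-{k}. (tau $ i)\<^sup>2 / c"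
  have z: "?z \<ge> 1" using tangential_norm2_nonneg[of k r w] by simp
  have sp: "?s > 0" "?s1 > 0" by (rule gnomonic_scale_pos)+
  have "sqrt ?z \<le> ?z"
    using z by (intro real_le_lsqrt) (auto simp: power2_eq_square)
  then have "?s1 \<le> ?z * ?s"
    using gnomonic_scale_1_le[OF r, of k w] sp by (meson mult_right_mono less_imp_le order_trans)
  then have "?s1 ^ n \<le> (?z * ?s) ^ n"
    using sp by (intro power_mono) auto
  then have "?s1 ^ n \<le> ?z ^ n * ?s ^ n" by (simp only: power_mult_distrib)
  moreover have "1 / S \<le> Z / S1" if "S1 \<le> Z * S" "S > 0" "S1 > 0" for S S1 Z :: real
    using that by (simp add: field_simps)
  ultimately have s: "1 / ?s ^ n \<le> ?z ^ n / ?s1 ^ n"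
    using sp by simp
  have "laplace_exponent lam tau k \<sigma> r w \<le> ?K + c / 2 - c / 2 * ?z"
    using laplace_exponent_le[where tau = tau, OF r \<sigma> c gap rc, of w] by (simp add: algebra_simps)
  then have e: "exp (laplace_exponent lam tau k \<sigma> r w) \<le> exp (?K + c / 2) * exp (- (c / 2 * ?z))"
    unfolding exp_add[symmetric] by simp
  have "\<bar>g * exp (laplace_exponent lam tau k \<sigma> r w) / ?s ^ n\<bar> =
      \<bar>g\<bar> * exp (laplace_exponent lam tau k \<sigma> r w) * (1 / ?s ^ n)"
    using sp by (simp add: abs_mult)
  also have "\<dots> \<le> ?z * (exp (?K + c / 2) * exp (- (c / 2 * ?z))) * (?z ^ n / ?s1 ^ n)"
    using g e s z sp by (intro mult_mono) auto
  also have "\<dots> = exp (?K + c / 2) * (?z ^ (n + 1) * exp (- (c / 2 * ?z))) * (1 / ?s1 ^ n)"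
    by simp
  also have "\<dots> \<le> exp (?K + c / 2) * (real (n + 1) / (c / 2)) ^ (n + 1) * (1 / ?s1 ^ n)"
    using c z sp by (intro mult_right_mono mult_left_mono power_mult_exp_minus_le) auto
  finally show ?thesis .
qed

lemma gnomonic_scale_tendsto: "((\<lambda>r. gnomonic_scale k r w) \<longlongrightarrow> 1) at_top"
proof -
  have "((\<lambda>r. gnomonic_scale k r w) \<longlongrightarrow> sqrt (1 + (\<Sum>i\<in>-{k}. 0\<^sup>2))) at_top"
    unfolding gnomonic_scale_def
    by (intro tendsto_intros tendsto_divide_0[OF tendsto_const] filterlim_at_top_imp_at_infinity filterlim_ident)
  then show ?thesis by simp
qed

lemma gnomonic_coordinate_tendsto: "((\<lambda>r. w i / gnomonic_scale k r w) \<longlongrightarrow> w i) at_top"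
  using tendsto_divide[OF tendsto_const gnomonic_scale_tendsto, of "w i" k w] by simp

lemma laplace_exponent_tendsto:
  "((\<lambda>r. laplace_exponent lam tau k \<sigma> r w) \<longlongrightarrow> gaussian_exponent lam tau k w) at_top"
proof -
  have "((\<lambda>r. r / gnomonic_scale k r w - r) \<longlongrightarrow> 0) at_top"
  proof (rule Lim_null_comparison)
    show "\<forall>\<^sub>F r in at_top. norm (r / gnomonic_scale k r w - r) \<le> (\<Sum>i\<in>-{k}. (w i)\<^sup>2) / r"
      using eventually_gt_at_top[of 0]
    proof eventually_elim
      case (elim r)
      have "tangential_norm2 k r w * 1 \<le> tangential_norm2 k r w * (gnomonic_scale k r w)\<^sup>2"
        by (intro mult_left_mono tangential_norm2_nonneg) (simp add: gnomonic_scale_ge_1)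
      then have "tangential_norm2 k r w \<le> (\<Sum>i\<in>-{k}. (w i)\<^sup>2)"
        by (simp add: tangential_norm2_mult_scale)
      then have "tangential_norm2 k r w / r \<le> (\<Sum>i\<in>-{k}. (w i)\<^sup>2) / r"
        using elim by (intro divide_right_mono) auto
      with radial_defect_le[OF elim, of k w] show ?case by simp
    qed
    show "((\<lambda>r. (\<Sum>i\<in>-{k}. (w i)\<^sup>2) / r) \<longlongrightarrow> 0) at_top"
      by (intro tendsto_divide_0[OF tendsto_const] filterlim_at_top_imp_at_infinity filterlim_ident)
  qed
  then have "((\<lambda>r. laplace_exponent lam tau k \<sigma> r w) \<longlongrightarrow>
      gaussian_exponent lam tau k w + \<sigma> * tau $ k * 0) at_top"
    unfolding laplace_exponent_def gaussian_exponent_def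
    by (intro tendsto_intros gnomonic_coordinate_tendsto)
  then show ?thesis by simp
qed

definition laplace_integral ::
    "real ^ 'n::finite \<Rightarrow> real ^ 'n \<Rightarrow> 'n \<Rightarrow> (('n \<Rightarrow> real) \<Rightarrow> real) \<Rightarrow> real \<Rightarrow> real \<Rightarrow> real" where
  "laplace_integral lam tau k g \<sigma> r = (LINT w|PiM (-{k}) (\<lambda>_. lborel).
    g w * exp (laplace_exponent lam tau k \<sigma> r w) / gnomonic_scale k r w ^ CARD('n))"

lemma laplace_integral_tendsto:
  fixes k :: "'n::finite"
  assumes \<sigma>: "\<bar>\<sigma>\<bar> = 1" and gap: "\<forall>i\<in>-{k}. lam $ i < lam $ k"
    and [measurable]: "\<And>r. g r \<in> borel_measurable (PiM (-{k}) (\<lambda>_. lborel))"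
      "g' \<in> borel_measurable (PiM (-{k}) (\<lambda>_. lborel))"
    and bound: "\<And>r w. r > 0 \<Longrightarrow> \<bar>g r w\<bar> \<le> 1 + tangential_norm2 k r w"
    and lim: "\<And>w. ((\<lambda>r. g r w) \<longlongrightarrow> g' w) at_top"
  shows "((\<lambda>r. laplace_integral lam tau k (g r) \<sigma> r) \<longlongrightarrow>
    (LINT w|PiM (-{k}) (\<lambda>_. lborel). g' w * exp (gaussian_exponent lam tau k w))) at_top"
proof -
  have "\<exists>c>0. \<forall>i. i \<noteq> k \<longrightarrow> c \<le> lam $ k - lam $ i"
  proof (intro exI[of _ "Min (insert 1 ((\<lambda>i. lam $ k - lam $ i) ` (-{k})))"] conjI allI impI)
    show "0 < Min (insert 1 ((\<lambda>i. lam $ k - lam $ i) ` (-{k})))"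
      using gap by (subst Min_gr_iff) auto
    show "Min (insert 1 ((\<lambda>i. lam $ k - lam $ i) ` (-{k}))) \<le> lam $ k - lam $ i" if "i \<noteq> k" for i
      using that by (intro Min_le) auto
  qed
  then obtain c where c: "c > 0" "\<And>i. i \<noteq> k \<Longrightarrow> c \<le> lam $ k - lam $ i" by blast
  let ?C = "exp ((\<Sum>i\<in>-{k}. (tau $ i)\<^sup>2 / c) + c / 2) * (real (CARD('n) + 1) / (c / 2)) ^ (CARD('n) + 1)"
  show ?thesis
    unfolding laplace_integral_def
  proof (rule integral_dominated_convergence_at_top)
    \<comment> \<open>The dominating function is, up to a constant, the unit sphere's density in the chart.\<close>
    have "integrable (sphere_measure 1) (\<lambda>t :: real ^ 'n. 1 :: real)"
      by (intro integrable_sphere_continuous continuous_intros) simp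
    from integrable_gnomonic[OF _ _ this, of 1 k]
    have "integrable (PiM (-{k}) (\<lambda>_. lborel)) (\<lambda>w. 1 / gnomonic_scale k 1 w ^ CARD('n))" by simp
    then show "integrable (PiM (-{k}) (\<lambda>_. lborel)) (\<lambda>w. ?C * (1 / gnomonic_scale k 1 w ^ CARD('n)))"
      by (rule integrable_mult_right)
    show "AE w in PiM (-{k}) (\<lambda>_. lborel). ((\<lambda>r. g r w * exp (laplace_exponent lam tau k \<sigma> r w) /
        gnomonic_scale k r w ^ CARD('n)) \<longlongrightarrow> g' w * exp (gaussian_exponent lam tau k w)) at_top"
    proof (rule AE_I2)
      fix w
      have "((\<lambda>r. g r w * exp (laplace_exponent lam tau k \<sigma> r w) / gnomonic_scale k r w ^ CARD('n))
          \<longlongrightarrow> g' w * exp (gaussian_exponent lam tau k w) / 1 ^ CARD('n)) at_top"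
        by (intro tendsto_intros lim laplace_exponent_tendsto gnomonic_scale_tendsto) simp
      then show "((\<lambda>r. g r w * exp (laplace_exponent lam tau k \<sigma> r w) / gnomonic_scale k r w ^ CARD('n))
          \<longlongrightarrow> g' w * exp (gaussian_exponent lam tau k w)) at_top" by simp
    qed
    show "\<forall>\<^sub>F r in at_top. AE w in PiM (-{k}) (\<lambda>_. lborel).
        norm (g r w * exp (laplace_exponent lam tau k \<sigma> r w) / gnomonic_scale k r w ^ CARD('n)) \<le>
        ?C * (1 / gnomonic_scale k 1 w ^ CARD('n))"
      using eventually_gt_at_top[of 0] eventually_ge_at_top[of "4 * \<bar>tau $ k\<bar> / c"]
    proof eventually_elim
      case (elim r)
      then have "4 * \<bar>tau $ k\<bar> \<le> c * r" using c by (simp add: field_simps)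
      then show ?case
        unfolding real_norm_def
        by (intro AE_I2 laplace_dominated elim \<sigma> c bound)
    qed
  qed measurable
qed

section \<open>Weighing the two poles\<close>

lemma integral_sphere_laplace:
  fixes k :: "'n::finite" and g :: "real ^ 'n \<Rightarrow> real"
  assumes r: "r > 0" and g: "continuous_on UNIV g"
  shows "(LINT t|sphere_measure r. g t * exp (fisher_bingham_exponent lam tau t)) =
    exp (r\<^sup>2 * lam $ k) *
      (exp (r * tau $ k) * laplace_integral lam tau k (\<lambda>w. g (gnomonic_point k r 1 w)) 1 r +
       exp (- (r * tau $ k)) * laplace_integral lam tau k (\<lambda>w. g (gnomonic_point k r (-1) w)) (-1) r)"
proof -
  let ?F = "\<lambda>t. g t * exp (fisher_bingham_exponent lam tau t)"
  have F: "continuous_on UNIV ?F" by (intro continuous_intros g)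
  have J: "(LINT w|PiM (-{k}) (\<lambda>_. lborel). ?F (gnomonic_point k r \<sigma> w) / gnomonic_scale k r w ^ CARD('n)) =
      exp (r\<^sup>2 * lam $ k) * (exp (\<sigma> * (r * tau $ k)) *
        laplace_integral lam tau k (\<lambda>w. g (gnomonic_point k r \<sigma> w)) \<sigma> r)"
    if "\<bar>\<sigma>\<bar> = 1" for \<sigma>
    unfolding laplace_integral_def fisher_bingham_exponent_gnomonic[OF r that]
    by (subst integral_mult_right_zero[symmetric])+
       (auto intro!: Bochner_Integration.integral_cong simp: exp_add)
  show ?thesis
    using integral_sphere_gnomonic[OF r borel_measurable_continuous_onI[OF F] integrable_sphere_continuous[OF r F], of k]
    by (simp add: J distrib_left)
qed

text \<open>
  The moment of \<open>t\<^sub>k\<close> enters with opposite signs at the two poles, hence with the weights of \<open>sinh\<close>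
  (\<open>\<eta> = -1\<close>) in place of those of \<open>cosh\<close> (\<open>\<eta> = 1\<close>). In the former case cancellation is
  harmless only if \<open>\<tau> \<noteq> 0\<close>: one exponential is then eventually at least three times the other.
\<close>

lemma exp_sinh_cosh_dominates:
  fixes \<tau> \<eta> :: real
  assumes "\<eta> = 1 \<or> \<eta> = -1 \<and> \<tau> \<noteq> 0"
  shows "\<forall>\<^sub>F r in at_top. exp (- (r * \<tau>)) \<le> 2 * \<bar>exp (r * \<tau>) + \<eta> * exp (- (r * \<tau>))\<bar>"
  using assms
proof
  assume [simp]: "\<eta> = 1"
  have "exp (- (r * \<tau>)) \<le> 2 * \<bar>exp (r * \<tau>) + \<eta> * exp (- (r * \<tau>))\<bar>" for r
    using exp_gt_zero[of "r * \<tau>"] exp_gt_zero[of "- (r * \<tau>)"] by (simp add: abs_of_pos add_pos_pos)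
  then show ?thesis by simp
next
  assume \<eta>: "\<eta> = -1 \<and> \<tau> \<noteq> 0"
  have exp3: "3 * exp (- x) \<le> exp x" if "x \<ge> 1" for x :: real
  proof -
    have "3 \<le> exp (2 * x)" using exp_ge_add_one_self[of "2 * x"] that by linarith
    then have "3 * exp (- x) \<le> exp (2 * x) * exp (- x)" by (intro mult_right_mono) auto
    then show ?thesis by (simp flip: exp_add)
  qed
  show ?thesis using eventually_ge_at_top[of "1 / \<bar>\<tau>\<bar>"]
  proof eventually_elim
    case (elim r)
    then have "1 \<le> r * \<bar>\<tau>\<bar>" using \<eta> by (simp add: field_simps)
    then have "r * \<tau> \<ge> 1 \<or> - (r * \<tau>) \<ge> 1" by (auto simp: abs_if split: if_splits)
    then have "3 * exp (- (r * \<tau>)) \<le> exp (r * \<tau>) \<or> 3 * exp (r * \<tau>) \<le> exp (- (r * \<tau>))"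
      using exp3[of "r * \<tau>"] exp3[of "- (r * \<tau>)"] by auto
    moreover have "q \<le> 2 * \<bar>p + \<eta> * q\<bar>" if "3 * q \<le> p \<or> 3 * p \<le> q" "p > 0" "q > 0" for p q
      using that \<eta> by (auto simp: abs_if)
    ultimately show ?case by simp
  qed
qed

text \<open>
  The mean differs from \<open>A\<close> by \<open>q / (p + q)\<close> times \<open>B - A\<close>, and the quotient is bounded. The weights may have
  opposite signs.
\<close>

lemma tendsto_weighted_mean:
  fixes A B p q :: "'a \<Rightarrow> real"
  assumes A: "(A \<longlongrightarrow> L) F" and B: "(B \<longlongrightarrow> L) F"
    and K: "\<forall>\<^sub>F x in F. \<bar>q x\<bar> \<le> K * \<bar>p x + q x\<bar>" and nz: "\<forall>\<^sub>F x in F. p x + q x \<noteq> 0"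
  shows "((\<lambda>x. (p x * A x + q x * B x) / (p x + q x)) \<longlongrightarrow> L) F"
proof -
  have "((\<lambda>x. (p x * A x + q x * B x) / (p x + q x) - A x) \<longlongrightarrow> 0) F"
  proof (rule Lim_null_comparison)
    show "\<forall>\<^sub>F x in F. norm ((p x * A x + q x * B x) / (p x + q x) - A x) \<le> K * \<bar>B x - A x\<bar>"
      using K nz
    proof eventually_elim
      case (elim x)
      have "(p x * A x + q x * B x) / (p x + q x) - A x = q x / (p x + q x) * (B x - A x)"
        using elim by (simp add: field_simps)
      moreover have "\<bar>q x / (p x + q x)\<bar> \<le> K"
        using elim by (simp add: abs_divide pos_divide_le_eq)
      ultimately show ?case
        by (simp only: real_norm_def abs_mult) (intro mult_right_mono, auto)
    qed
    have "((\<lambda>x. K * \<bar>B x - A x\<bar>) \<longlongrightarrow> K * \<bar>L - L\<bar>) F"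
      by (intro tendsto_intros A B)
    then show "((\<lambda>x. K * \<bar>B x - A x\<bar>) \<longlongrightarrow> 0) F" by simp
  qed
  from tendsto_add[OF this A] show ?thesis by simp
qed

text \<open>
  The common form of all five asymptotic formulas. In the chart, the integrand \<open>g\<close> is a normalizing power
  \<open>h r\<close> of the radius times a function \<open>\<gamma> r\<close> of the tangent vector that converges; \<open>\<eta> = -1\<close> is for
  integrands that change sign between the poles.
\<close>

lemma sphere_moment_tendsto:
  fixes k :: "'n::finite"
  assumes gap: "\<forall>i\<in>-{k}. lam $ i < lam $ k"
    and \<eta>: "\<eta> = 1 \<or> \<eta> = -1 \<and> tau $ k \<noteq> 0"
    and g: "continuous_on UNIV g"
    and g_eq: "\<And>r w. r > 0 \<Longrightarrow> g (gnomonic_point k r 1 w) = h r * \<gamma> r w"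
      "\<And>r w. r > 0 \<Longrightarrow> g (gnomonic_point k r (-1) w) = \<eta> * h r * \<gamma> r w"
    and h: "\<And>r. r > 0 \<Longrightarrow> h r \<noteq> 0"
    and \<gamma>: "\<And>r. \<gamma> r \<in> borel_measurable (PiM (-{k}) (\<lambda>_. lborel))"
      "\<gamma>' \<in> borel_measurable (PiM (-{k}) (\<lambda>_. lborel))"
    and bound: "\<And>r w. r > 0 \<Longrightarrow> \<bar>\<gamma> r w\<bar> \<le> 1 + tangential_norm2 k r w"
    and lim: "\<And>w. ((\<lambda>r. \<gamma> r w) \<longlongrightarrow> \<gamma>' w) at_top"
  shows "((\<lambda>r. (LINT t|sphere_measure r. g t * exp (fisher_bingham_exponent lam tau t)) /
      (h r * (exp (r\<^sup>2 * lam $ k) * (exp (r * tau $ k) + \<eta> * exp (- (r * tau $ k)))))) \<longlongrightarrow>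
    (LINT w|PiM (-{k}) (\<lambda>_. lborel). \<gamma>' w * exp (gaussian_exponent lam tau k w))) at_top"
    (is "((\<lambda>r. ?M r / (h r * (?e r * (?p r + \<eta> * ?q r)))) \<longlongrightarrow> ?L) at_top")
proof -
  define J where "J \<sigma> r = laplace_integral lam tau k (\<gamma> r) \<sigma> r" for \<sigma> r
  have J: "((\<lambda>r. J \<sigma> r) \<longlongrightarrow> ?L) at_top" if "\<bar>\<sigma>\<bar> = 1" for \<sigma>
    unfolding J_def using that gap \<gamma> bound lim by (rule laplace_integral_tendsto)
  have scale: "laplace_integral lam tau k (\<lambda>w. a * \<gamma> r w) \<sigma> r = a * J \<sigma> r" for a \<sigma> r
    unfolding laplace_integral_def J_def
    by (subst integral_mult_right_zero[symmetric]) (simp add: mult.assoc)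
  have M: "?M r = h r * (?e r * (?p r * J 1 r + \<eta> * ?q r * J (-1) r))" if "r > 0" for r
  proof -
    have "?M r = ?e r * (?p r * (h r * J 1 r) + ?q r * (\<eta> * h r * J (-1) r))"
      by (simp only: integral_sphere_laplace[OF that g, of _ _ k] g_eq[OF that] scale)
    then show ?thesis by (simp add: algebra_simps)
  qed
  have dom: "\<forall>\<^sub>F r in at_top. ?q r \<le> 2 * \<bar>?p r + \<eta> * ?q r\<bar>"
    by (rule exp_sinh_cosh_dominates[OF \<eta>])
  have "((\<lambda>r. (?p r * J 1 r + \<eta> * ?q r * J (-1) r) / (?p r + \<eta> * ?q r)) \<longlongrightarrow> ?L) at_top"
  proof (rule tendsto_weighted_mean[where K=2])
    show "\<forall>\<^sub>F r in at_top. \<bar>\<eta> * ?q r\<bar> \<le> 2 * \<bar>?p r + \<eta> * ?q r\<bar>"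
      using dom \<eta> by (auto simp: abs_mult)
    show "\<forall>\<^sub>F r in at_top. ?p r + \<eta> * ?q r \<noteq> 0"
      using dom
    proof eventually_elim
      case (elim r)
      show ?case
      proof
        assume "?p r + \<eta> * ?q r = 0"
        with elim have "?q r \<le> 0" by simp
        then show False by simp
      qed
    qed
  qed (use J in auto)
  then show ?thesis
    by (rule Lim_transform_eventually)
       (use eventually_gt_at_top[of 0] in eventually_elim, simp add: M h)
qed

section \<open>Gaussian integrals\<close>

text \<open>
  Completing the square, the integrand is \<open>Z\<close> times the normal density with mean \<open>b / (2 a)\<close> and variance
  \<open>1 / (2 a)\<close>.
\<close>

lemma gaussian_has_bochner_integral:
  fixes a b :: real
  assumes a: "a > 0"
  defines "Z \<equiv> sqrt (pi / a) * exp (b\<^sup>2 / (4 * a))"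
  shows "has_bochner_integral lborel (\<lambda>x. exp (b * x - a * x\<^sup>2)) Z"
    and "has_bochner_integral lborel (\<lambda>x. x * exp (b * x - a * x\<^sup>2)) (b / (2 * a) * Z)"
    and "has_bochner_integral lborel (\<lambda>x. x\<^sup>2 * exp (b * x - a * x\<^sup>2))
      (((b / (2 * a))\<^sup>2 + 1 / (2 * a)) * Z)"
proof -
  define \<mu> where "\<mu> = b / (2 * a)"
  define \<sigma> where "\<sigma> = sqrt (1 / (2 * a))"
  have \<sigma>: "\<sigma> > 0" "\<sigma>\<^sup>2 = 1 / (2 * a)" using a by (simp_all add: \<sigma>_def)
  have eq: "exp (b * x - a * x\<^sup>2) = Z * normal_density \<mu> \<sigma> x" for x
  proof -
    have "Z * normal_density \<mu> \<sigma> x = exp (b\<^sup>2 / (4 * a)) * exp (- (x - \<mu>)\<^sup>2 / (2 * \<sigma>\<^sup>2))"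
      using a by (simp add: Z_def normal_density_def \<sigma> real_sqrt_divide)
    also have "\<dots> = exp (b\<^sup>2 / (4 * a) - a * (x - \<mu>)\<^sup>2)"
      by (simp add: \<sigma> flip: exp_add)
    also have "b\<^sup>2 / (4 * a) - a * (x - \<mu>)\<^sup>2 = b * x - a * x\<^sup>2"
      using a by (simp add: \<mu>_def field_simps power2_eq_square)
    finally show ?thesis by simp
  qed
  have 0: "has_bochner_integral lborel (normal_density \<mu> \<sigma>) 1"
    using normal_moment_even[OF \<sigma>(1), of \<mu> 0] by simp
  have 1: "has_bochner_integral lborel (\<lambda>x. normal_density \<mu> \<sigma> x * x) \<mu>"
    by (rule normal_moment_nz_1[OF \<sigma>(1)])
  have 2: "has_bochner_integral lborel (\<lambda>x. normal_density \<mu> \<sigma> x * (x - \<mu>)\<^sup>2) (\<sigma>\<^sup>2)"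
    using normal_moment_even[OF \<sigma>(1), of \<mu> 1] by simp
  show "has_bochner_integral lborel (\<lambda>x. exp (b * x - a * x\<^sup>2)) Z"
    using has_bochner_integral_mult_right[OF 0, of Z] by (simp add: eq)
  show "has_bochner_integral lborel (\<lambda>x. x * exp (b * x - a * x\<^sup>2)) (b / (2 * a) * Z)"
  proof -
    have "(\<lambda>x. x * exp (b * x - a * x\<^sup>2)) = (\<lambda>x. Z * (normal_density \<mu> \<sigma> x * x))"
      by (simp add: eq fun_eq_iff)
    then show ?thesis
      using has_bochner_integral_mult_right[OF 1, of Z] by (simp only: \<mu>_def mult.commute)
  qed
  have "has_bochner_integral lborel (\<lambda>x. normal_density \<mu> \<sigma> x * (x - \<mu>)\<^sup>2 +
      2 * \<mu> * (normal_density \<mu> \<sigma> x * x) - \<mu>\<^sup>2 * normal_density \<mu> \<sigma> x)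
      (\<sigma>\<^sup>2 + 2 * \<mu> * \<mu> - \<mu>\<^sup>2 * 1)"
    by (intro has_bochner_integral_diff has_bochner_integral_add has_bochner_integral_mult_right 0 1 2)
  also have "(\<lambda>x. normal_density \<mu> \<sigma> x * (x - \<mu>)\<^sup>2 +
      2 * \<mu> * (normal_density \<mu> \<sigma> x * x) - \<mu>\<^sup>2 * normal_density \<mu> \<sigma> x) = (\<lambda>x. normal_density \<mu> \<sigma> x * x\<^sup>2)"
    by (simp add: fun_eq_iff power2_eq_square algebra_simps)
  also have "\<sigma>\<^sup>2 + 2 * \<mu> * \<mu> - \<mu>\<^sup>2 * 1 = (b / (2 * a))\<^sup>2 + 1 / (2 * a)"
    unfolding \<sigma>(2) \<mu>_def by (simp add: power2_eq_square)
  finally have 3: "has_bochner_integral lborel (\<lambda>x. normal_density \<mu> \<sigma> x * x\<^sup>2)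
      ((b / (2 * a))\<^sup>2 + 1 / (2 * a))" .
  show "has_bochner_integral lborel (\<lambda>x. x\<^sup>2 * exp (b * x - a * x\<^sup>2))
      (((b / (2 * a))\<^sup>2 + 1 / (2 * a)) * Z)"
  proof -
    have "(\<lambda>x. x\<^sup>2 * exp (b * x - a * x\<^sup>2)) = (\<lambda>x. Z * (normal_density \<mu> \<sigma> x * x\<^sup>2))"
      by (simp add: eq fun_eq_iff)
    then show ?thesis
      using has_bochner_integral_mult_right[OF 3, of Z] by (simp only: mult.commute)
  qed
qed

text \<open>
  The total mass of \<open>exp (gaussian_exponent lam tau k w)\<close>, as a product of one-dimensional masses.
\<close>

definition gaussian_mass :: "real ^ 'n::finite \<Rightarrow> real ^ 'n \<Rightarrow> 'n \<Rightarrow> real" where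
  "gaussian_mass lam tau k = (\<Prod>i\<in>-{k}. sqrt (pi / (lam $ k - lam $ i)) *
    exp ((tau $ i)\<^sup>2 / (4 * (lam $ k - lam $ i))))"

lemma gaussian_mass_pos:
  assumes "\<forall>i\<in>-{k}. lam $ i < lam $ k"
  shows "gaussian_mass lam tau k > 0"
  unfolding gaussian_mass_def using assms by (intro prod_pos) auto

text \<open>
  The integrand is a product over the coordinates, so Fubini reduces the claim to the one-dimensional integrals;
  \<open>m i\<close> is the mean of \<open>u i\<close> under the normalized \<open>i\<close>-th Gaussian.
\<close>

lemma gaussian_product_integral:
  fixes k :: "'n::finite"
  assumes u: "\<And>i. i \<in> -{k} \<Longrightarrow> has_bochner_integral lborel
      (\<lambda>x. u i x * exp (tau $ i * x - (lam $ k - lam $ i) * x\<^sup>2))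
      (m i * (sqrt (pi / (lam $ k - lam $ i)) * exp ((tau $ i)\<^sup>2 / (4 * (lam $ k - lam $ i)))))"
  shows "(LINT w|PiM (-{k}) (\<lambda>_. lborel).
      (\<Prod>i\<in>-{k}. u i (w i)) * exp (gaussian_exponent lam tau k w)) =
    (\<Prod>i\<in>-{k}. m i) * gaussian_mass lam tau k"
proof -
  define v where "v i x = u i x * exp (tau $ i * x - (lam $ k - lam $ i) * x\<^sup>2)" for i x
  have "(\<Prod>i\<in>-{k}. u i (w i)) * exp (gaussian_exponent lam tau k w) = (\<Prod>i\<in>-{k}. v i (w i))" for w
    by (simp only: v_def prod.distrib gaussian_exponent_def exp_sum[OF finite])
  then have "(LINT w|PiM (-{k}) (\<lambda>_. lborel).
      (\<Prod>i\<in>-{k}. u i (w i)) * exp (gaussian_exponent lam tau k w)) =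
      (LINT w|PiM (-{k}) (\<lambda>_. lborel). (\<Prod>i\<in>-{k}. v i (w i)))" by simp
  also have "\<dots> = (\<Prod>i\<in>-{k}. integral\<^sup>L lborel (v i))"
    by (rule lborel_product.product_integral_prod)
       (use u in \<open>auto simp: v_def[abs_def] intro: integrable.intros\<close>)
  also have "\<dots> = (\<Prod>i\<in>-{k}. m i *
      (sqrt (pi / (lam $ k - lam $ i)) * exp ((tau $ i)\<^sup>2 / (4 * (lam $ k - lam $ i)))))"
    unfolding v_def[abs_def] using u by (intro prod.cong refl has_bochner_integral_integral_eq)
  finally show ?thesis by (simp only: prod.distrib gaussian_mass_def)
qed

lemma gaussian_mass_eq_integral:
  fixes k :: "'n::finite"
  assumes gap: "\<forall>i\<in>-{k}. lam $ i < lam $ k"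
  shows "(LINT w|PiM (-{k}) (\<lambda>_. lborel). 1 * exp (gaussian_exponent lam tau k w)) =
    gaussian_mass lam tau k"
proof -
  have "has_bochner_integral lborel (\<lambda>x. 1 * exp (tau $ i * x - (lam $ k - lam $ i) * x\<^sup>2))
      (1 * (sqrt (pi / (lam $ k - lam $ i)) * exp ((tau $ i)\<^sup>2 / (4 * (lam $ k - lam $ i)))))"
    if "i \<in> -{k}" for i
    using gaussian_has_bochner_integral(1)[of "lam $ k - lam $ i" "tau $ i"] gap that by simp
  from gaussian_product_integral[where u="\<lambda>_ _. 1" and m="\<lambda>_. 1", OF this] show ?thesis by simp
qed

lemma gaussian_coordinate_integral:
  fixes k :: "'n::finite"
  assumes gap: "\<forall>i\<in>-{k}. lam $ i < lam $ k" and j: "j \<noteq> k"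
    and u: "has_bochner_integral lborel
      (\<lambda>x. u x * exp (tau $ j * x - (lam $ k - lam $ j) * x\<^sup>2))
      (m * (sqrt (pi / (lam $ k - lam $ j)) * exp ((tau $ j)\<^sup>2 / (4 * (lam $ k - lam $ j)))))"
  shows "(LINT w|PiM (-{k}) (\<lambda>_. lborel). u (w j) * exp (gaussian_exponent lam tau k w)) =
    m * gaussian_mass lam tau k"
proof -
  have delta: "(\<Prod>i\<in>-{k}. if i = j then c else 1) = c" for c :: real
    using j by (simp add: prod.delta)
  have "(\<Prod>i\<in>-{k}. if i = j then u (w i) else 1) = (\<Prod>i\<in>-{k}. if i = j then u (w j) else 1)" for w
    by (intro prod.cong) auto
  then have prod_u: "(\<Prod>i\<in>-{k}. if i = j then u (w i) else 1) = u (w j)" for w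
    by (simp only: delta)
  have "has_bochner_integral lborel
      (\<lambda>x. (if i = j then u x else 1) * exp (tau $ i * x - (lam $ k - lam $ i) * x\<^sup>2))
      ((if i = j then m else 1) *
        (sqrt (pi / (lam $ k - lam $ i)) * exp ((tau $ i)\<^sup>2 / (4 * (lam $ k - lam $ i)))))"
    if "i \<in> -{k}" for i
    using u gaussian_has_bochner_integral(1)[of "lam $ k - lam $ i" "tau $ i"] gap that
    by (cases "i = j") auto
  from gaussian_product_integral[where u="\<lambda>i x. if i = j then u x else 1", OF this]
  show ?thesis by (simp only: prod_u delta)
qed

section \<open>Asymptotics of the integral and its derivatives\<close>

lemma fisher_bingham_pos:
  assumes r: "r > 0"
  shows "fisher_bingham lam tau r > 0"
proof -
  let ?F = "\<lambda>t. exp (fisher_bingham_exponent lam tau t)"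
  have int: "integrable (sphere_measure r) ?F"
    by (intro integrable_sphere_continuous r continuous_intros)
  have "fisher_bingham lam tau r \<noteq> 0"
  proof
    assume "fisher_bingham lam tau r = 0"
    then have "AE t in sphere_measure r. ?F t = 0"
      using integral_nonneg_eq_0_iff_AE[OF int] by (simp add: fisher_bingham_eq)
    then have "AE t in (sphere_measure r :: (real ^ 'a) measure). False" by simp
    then have "emeasure (sphere_measure r) (sphere 0 r :: (real ^ 'a) set) = 0"
      by (simp add: eventually_False ae_filter_eq_bot_iff)
    moreover have "Gamma (real CARD('a) / 2) > 0" by (rule Gamma_real_pos) auto
    ultimately show False
      using r by (simp add: emeasure_sphere_measure_space[OF r])
  qed
  moreover have "fisher_bingham lam tau r \<ge> 0"
    unfolding fisher_bingham_eq by (intro integral_nonneg_AE) auto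
  ultimately show ?thesis by simp
qed

lemma eq_times_1_plus_o1_zero:
  assumes "\<And>r. r > 0 \<Longrightarrow> A r = 0" "\<And>r. r > 0 \<Longrightarrow> B r = 0"
  shows "eq_times_1_plus_o1 A B"
  unfolding eq_times_1_plus_o1_def by (rule exI[of _ "\<lambda>_. 0"]) (simp add: assms)

lemma eq_times_1_plus_o1I:
  assumes "((\<lambda>r. A r / B r) \<longlongrightarrow> 1) at_top" and "\<And>r. r > 0 \<Longrightarrow> B r \<noteq> 0"
  shows "eq_times_1_plus_o1 A B"
  unfolding eq_times_1_plus_o1_def
  by (rule exI[of _ "\<lambda>r. A r / B r - 1"])
     (use assms tendsto_diff[OF assms(1) tendsto_const[of 1]] in auto)

lemma eq_times_1_plus_o1_cong:
  assumes "\<And>r. r > 0 \<Longrightarrow> A r = A' r" "eq_times_1_plus_o1 A' B"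
  shows "eq_times_1_plus_o1 A B"
  using assms unfolding eq_times_1_plus_o1_def by simp

text \<open>
  The asymptotics of the derivatives are stated relative to \<open>f\<close>; this divides two absolute ones.
\<close>

lemma eq_times_1_plus_o1_ratio:
  assumes M: "((\<lambda>r. M r / V r) \<longlongrightarrow> c * L) at_top" and f: "((\<lambda>r. f r / W r) \<longlongrightarrow> L) at_top"
    and nz: "L \<noteq> 0" "c \<noteq> 0" "\<And>r. r > 0 \<Longrightarrow> V r \<noteq> 0" "\<And>r. r > 0 \<Longrightarrow> W r \<noteq> 0" "\<And>r. r > 0 \<Longrightarrow> f r \<noteq> 0"
    and B: "\<And>r. r > 0 \<Longrightarrow> B r = c * (V r / W r) * f r"
  shows "eq_times_1_plus_o1 M B"
proof (rule eq_times_1_plus_o1I)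
  have "((\<lambda>r. (M r / V r) / (c * (f r / W r))) \<longlongrightarrow> c * L / (c * L)) at_top"
    using nz by (intro tendsto_intros M f) auto
  then have "((\<lambda>r. (M r / V r) / (c * (f r / W r))) \<longlongrightarrow> 1) at_top"
    using nz by simp
  then show "((\<lambda>r. M r / B r) \<longlongrightarrow> 1) at_top"
    by (rule Lim_transform_eventually)
       (use eventually_gt_at_top[of 0] in eventually_elim, simp add: B nz field_simps)
qed (simp add: B nz)

text \<open>
  In the chart around the pole on the \<open>j\<close>-axis itself, \<open>t\<^sub>j\<close> is \<open>\<sigma>\<close> times a function of \<open>w\<close>, and
  with \<open>\<tau>\<^sub>j = 0\<close> nothing else depends on \<open>\<sigma>\<close>, so the two hemispheres cancel.
\<close>

lemma sphere_moment_eq_0_if_odd: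
  assumes r: "r > 0" and tau: "tau $ j = 0"
  shows "(LINT t|sphere_measure r. t $ j * exp (fisher_bingham_exponent lam tau t)) = 0"
proof -
  define G where "G \<sigma> = (\<lambda>w. gnomonic_point j r \<sigma> w $ j)" for \<sigma>
  have "laplace_integral lam tau j (G (-1)) (-1) r = - laplace_integral lam tau j (G 1) 1 r"
    unfolding laplace_integral_def
    by (subst Bochner_Integration.integral_minus[symmetric])
       (simp add: G_def gnomonic_point_def laplace_exponent_def tau)
  then show ?thesis
    unfolding integral_sphere_laplace[where g="\<lambda>t. t $ j" and k=j, OF r continuous_on_component[OF continuous_on_id]]
    by (simp add: tau G_def)
qed

lemma coordinate_power2_le_tangential_norm2:
  "i \<noteq> k \<Longrightarrow> (w i / gnomonic_scale k r w)\<^sup>2 \<le> tangential_norm2 k r w"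
  unfolding tangential_norm2_def by (rule member_le_sum) auto

text \<open>
  The growth of the integral up to the constant factor \<open>gaussian_mass lam tau k\<close>.
\<close>

definition fisher_bingham_scale :: "real ^ 'n::finite \<Rightarrow> real ^ 'n \<Rightarrow> 'n \<Rightarrow> real \<Rightarrow> real" where
  "fisher_bingham_scale lam tau k r =
    exp (r\<^sup>2 * lam $ k) * (exp (r * tau $ k) + exp (- (r * tau $ k)))"

lemma fisher_bingham_scale_pos: "fisher_bingham_scale lam tau k r > 0"
  by (simp add: fisher_bingham_scale_def add_pos_pos)

lemma sphere_even_moment_tendsto:
  fixes k :: "'n::finite"
  assumes gap: "\<forall>i\<in>-{k}. lam $ i < lam $ k"
    and g: "continuous_on UNIV g"
    and g_eq: "\<And>r \<sigma> w. r > 0 \<Longrightarrow> \<bar>\<sigma>\<bar> = 1 \<Longrightarrow> g (gnomonic_point k r \<sigma> w) = h r * \<gamma> r w"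
    and h: "\<And>r. r > 0 \<Longrightarrow> h r \<noteq> 0"
    and \<gamma>: "\<And>r. \<gamma> r \<in> borel_measurable (PiM (-{k}) (\<lambda>_. lborel))"
      "\<gamma>' \<in> borel_measurable (PiM (-{k}) (\<lambda>_. lborel))"
    and bound: "\<And>r w. r > 0 \<Longrightarrow> \<bar>\<gamma> r w\<bar> \<le> 1 + tangential_norm2 k r w"
    and lim: "\<And>w. ((\<lambda>r. \<gamma> r w) \<longlongrightarrow> \<gamma>' w) at_top"
  shows "((\<lambda>r. (LINT t|sphere_measure r. g t * exp (fisher_bingham_exponent lam tau t)) /
      (h r * fisher_bingham_scale lam tau k r)) \<longlongrightarrow>
    (LINT w|PiM (-{k}) (\<lambda>_. lborel). \<gamma>' w * exp (gaussian_exponent lam tau k w))) at_top"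
proof -
  have 1: "g (gnomonic_point k r (-1) w) = 1 * h r * \<gamma> r w" if "r > 0" for r w
    using g_eq[OF that] by simp
  show ?thesis
    using sphere_moment_tendsto[where \<eta>=1 and tau=tau, OF gap _ g g_eq 1 h \<gamma> bound lim]
    by (simp add: fisher_bingham_scale_def)
qed

lemma fisher_bingham_tendsto:
  assumes gap: "\<forall>i\<in>-{k}. lam $ i < lam $ k"
  shows "((\<lambda>r. fisher_bingham lam tau r / fisher_bingham_scale lam tau k r) \<longlongrightarrow>
    gaussian_mass lam tau k) at_top"
proof -
  have "((\<lambda>r. (LINT t|sphere_measure r. 1 * exp (fisher_bingham_exponent lam tau t)) /
      (1 * fisher_bingham_scale lam tau k r)) \<longlongrightarrow>
      (LINT w|PiM (-{k}) (\<lambda>_. lborel). 1 * exp (gaussian_exponent lam tau k w))) at_top"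
    by (rule sphere_even_moment_tendsto[where \<gamma>="\<lambda>_ _. 1", OF gap])
       (auto simp: tangential_norm2_nonneg)
  then show ?thesis unfolding gaussian_mass_eq_integral[OF gap] by (simp add: fisher_bingham_eq)
qed

lemma tendsto_inverse_gnomonic_scale: "((\<lambda>r. 1 / gnomonic_scale k r w) \<longlongrightarrow> 1) at_top"
  using tendsto_divide[OF tendsto_const gnomonic_scale_tendsto, of 1 k w] by simp

lemma inverse_gnomonic_scale_le: "\<bar>1 / gnomonic_scale k r w\<bar> \<le> 1 + tangential_norm2 k r w"
proof -
  have "\<bar>1 / gnomonic_scale k r w\<bar> \<le> 1"
    using gnomonic_scale_ge_1[of k r w] by simp
  then show ?thesis using tangential_norm2_nonneg[of k r w] by linarith
qed

text \<open>
  The four derivatives are handled alike: \<open>M\<close> is the moment that represents the derivative for \<open>r > 0\<close>,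
  \<open>V\<close> its growth, and \<open>c\<close> the mean of the limiting integrand under the normalized Gaussian.
\<close>

lemma eq_times_1_plus_o1_fisher_bingham:
  assumes gap: "\<forall>i\<in>-{k}. lam $ i < lam $ k"
    and A: "\<And>r. r > 0 \<Longrightarrow> A r = M r"
    and M: "((\<lambda>r. M r / V r) \<longlongrightarrow> c * gaussian_mass lam tau k) at_top"
    and nz: "c \<noteq> 0" "\<And>r. r > 0 \<Longrightarrow> V r \<noteq> 0"
    and B: "\<And>r. r > 0 \<Longrightarrow> B r = c * (V r / fisher_bingham_scale lam tau k r) * fisher_bingham lam tau r"
  shows "eq_times_1_plus_o1 A B"
proof (rule eq_times_1_plus_o1_cong[OF A])
  show "eq_times_1_plus_o1 M B"
    using gaussian_mass_pos[of k lam tau, OF gap] fisher_bingham_pos[of _ lam tau]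
      fisher_bingham_scale_pos[of lam tau k] nz
    by (intro eq_times_1_plus_o1_ratio[OF M fisher_bingham_tendsto[OF gap] _ _ _ _ _ B])
       (auto simp: less_imp_neq[symmetric])
qed

lemma partial_lam_leading_asymp:
  assumes gap: "\<forall>i\<in>-{k}. lam $ i < lam $ k"
  shows "eq_times_1_plus_o1 (\<lambda>r. partial_deriv k (\<lambda>l. fisher_bingham l tau r) lam)
    (\<lambda>r. r\<^sup>2 * fisher_bingham lam tau r)"
proof (rule eq_times_1_plus_o1_fisher_bingham[OF gap fisher_bingham_partial_lam(2), where c=1])
  have sq: "(1 / gnomonic_scale k r w)\<^sup>2 \<le> 1" for r w
    using gnomonic_scale_ge_1[of k r w] by (simp add: power_le_one power_divide)
  have "((\<lambda>r. (LINT t|sphere_measure r. (t $ k)\<^sup>2 * exp (fisher_bingham_exponent lam tau t)) /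
      (r\<^sup>2 * fisher_bingham_scale lam tau k r)) \<longlongrightarrow>
      (LINT w|PiM (-{k}) (\<lambda>_. lborel). 1 * exp (gaussian_exponent lam tau k w))) at_top"
  proof (rule sphere_even_moment_tendsto[where \<gamma>="\<lambda>r w. (1 / gnomonic_scale k r w)\<^sup>2", OF gap])
    show "(gnomonic_point k r \<sigma> w $ k)\<^sup>2 = r\<^sup>2 * (1 / gnomonic_scale k r w)\<^sup>2" if "\<bar>\<sigma>\<bar> = 1" for r \<sigma> w
    proof -
      have "\<sigma>\<^sup>2 = 1" using that by (metis power2_abs one_power2)
      then show ?thesis by (simp add: gnomonic_point_def power_divide power_mult_distrib)
    qed
    show "\<bar>(1 / gnomonic_scale k r w)\<^sup>2\<bar> \<le> 1 + tangential_norm2 k r w" for r w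
      unfolding abs_power2 using sq[of r w] tangential_norm2_nonneg[of k r w] by linarith
    show "((\<lambda>r. (1 / gnomonic_scale k r w)\<^sup>2) \<longlongrightarrow> 1) at_top" for w
      using tendsto_power[OF tendsto_inverse_gnomonic_scale, of k w 2] by simp
  qed (auto intro!: continuous_intros)
  then show "((\<lambda>r. (LINT t|sphere_measure r. (t $ k)\<^sup>2 * exp (fisher_bingham_exponent lam tau t)) /
      (r\<^sup>2 * fisher_bingham_scale lam tau k r)) \<longlongrightarrow> 1 * gaussian_mass lam tau k) at_top"
    unfolding gaussian_mass_eq_integral[OF gap] by simp
qed (use fisher_bingham_scale_pos[of lam tau k] in \<open>auto simp: less_imp_neq[symmetric]\<close>)

lemma partial_lam_tangential_asymp:
  assumes gap: "\<forall>i\<in>-{k}. lam $ i < lam $ k" and j: "j \<noteq> k"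
  shows "eq_times_1_plus_o1 (\<lambda>r. partial_deriv j (\<lambda>l. fisher_bingham l tau r) lam)
    (\<lambda>r. ((tau $ j / (2 * (lam $ k - lam $ j)))\<^sup>2 + 1 / (2 * (lam $ k - lam $ j))) *
      fisher_bingham lam tau r)"
proof (rule eq_times_1_plus_o1_fisher_bingham[OF gap fisher_bingham_partial_lam(2),
      where c="(tau $ j / (2 * (lam $ k - lam $ j)))\<^sup>2 + 1 / (2 * (lam $ k - lam $ j))"])
  have a: "lam $ k - lam $ j > 0" using gap j by simp
  have "((\<lambda>r. (LINT t|sphere_measure r. (t $ j)\<^sup>2 * exp (fisher_bingham_exponent lam tau t)) /
      (1 * fisher_bingham_scale lam tau k r)) \<longlongrightarrow>
      (LINT w|PiM (-{k}) (\<lambda>_. lborel). (w j)\<^sup>2 * exp (gaussian_exponent lam tau k w))) at_top"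
  proof (rule sphere_even_moment_tendsto[where \<gamma>="\<lambda>r w. (w j / gnomonic_scale k r w)\<^sup>2", OF gap])
    show "\<bar>(w j / gnomonic_scale k r w)\<^sup>2\<bar> \<le> 1 + tangential_norm2 k r w" for r w
      using coordinate_power2_le_tangential_norm2[OF j, of w r] by simp
    show "((\<lambda>r. (w j / gnomonic_scale k r w)\<^sup>2) \<longlongrightarrow> (w j)\<^sup>2) at_top" for w
      by (intro tendsto_power gnomonic_coordinate_tendsto)
  qed (use j in \<open>auto intro!: continuous_intros simp: gnomonic_point_def\<close>)
  then show "((\<lambda>r. (LINT t|sphere_measure r. (t $ j)\<^sup>2 * exp (fisher_bingham_exponent lam tau t)) /
      fisher_bingham_scale lam tau k r) \<longlongrightarrow>
      ((tau $ j / (2 * (lam $ k - lam $ j)))\<^sup>2 + 1 / (2 * (lam $ k - lam $ j))) * gaussian_mass lam tau k) at_top"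
    unfolding gaussian_coordinate_integral[where tau=tau and u="\<lambda>x. x\<^sup>2", OF gap j
        gaussian_has_bochner_integral(3)[OF a]] by simp
  have "(tau $ j / (2 * (lam $ k - lam $ j)))\<^sup>2 + 1 / (2 * (lam $ k - lam $ j)) > 0"
    using a by (intro add_nonneg_pos) auto
  then show "(tau $ j / (2 * (lam $ k - lam $ j)))\<^sup>2 + 1 / (2 * (lam $ k - lam $ j)) \<noteq> 0" by simp
qed (use fisher_bingham_scale_pos[of lam tau k] in \<open>auto simp: less_imp_neq[symmetric]\<close>)

lemma partial_tau_leading_asymp:
  assumes gap: "\<forall>i\<in>-{k}. lam $ i < lam $ k"
  shows "eq_times_1_plus_o1 (\<lambda>r. partial_deriv k (\<lambda>t. fisher_bingham lam t r) tau)
    (\<lambda>r. r * ((exp (r * tau $ k) - exp (- (r * tau $ k))) / (exp (r * tau $ k) + exp (- (r * tau $ k)))) *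
      fisher_bingham lam tau r)"
proof (cases "tau $ k = 0")
  case True
  then show ?thesis
    by (intro eq_times_1_plus_o1_zero) (simp_all add: fisher_bingham_partial_tau sphere_moment_eq_0_if_odd)
next
  case False
  let ?V = "\<lambda>r. r * (exp (r\<^sup>2 * lam $ k) * (exp (r * tau $ k) + (-1) * exp (- (r * tau $ k))))"
  show ?thesis
  proof (rule eq_times_1_plus_o1_fisher_bingham[OF gap fisher_bingham_partial_tau(2), where c=1 and V="?V"])
    have "((\<lambda>r. (LINT t|sphere_measure r. t $ k * exp (fisher_bingham_exponent lam tau t)) / ?V r) \<longlongrightarrow>
        (LINT w|PiM (-{k}) (\<lambda>_. lborel). 1 * exp (gaussian_exponent lam tau k w))) at_top"
      by (rule sphere_moment_tendsto[where \<gamma>="\<lambda>r w. 1 / gnomonic_scale k r w", OF gap])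
         (use False in \<open>auto intro!: continuous_intros tendsto_inverse_gnomonic_scale inverse_gnomonic_scale_le
            simp: gnomonic_point_def simp del: abs_divide\<close>)
    then show "((\<lambda>r. (LINT t|sphere_measure r. t $ k * exp (fisher_bingham_exponent lam tau t)) / ?V r) \<longlongrightarrow>
        1 * gaussian_mass lam tau k) at_top"
      unfolding gaussian_mass_eq_integral[OF gap] by simp
    show "?V r \<noteq> 0" if "r > 0" for r
      using that False by auto
    show "r * ((exp (r * tau $ k) - exp (- (r * tau $ k))) / (exp (r * tau $ k) + exp (- (r * tau $ k)))) *
        fisher_bingham lam tau r =
        1 * (?V r / fisher_bingham_scale lam tau k r) * fisher_bingham lam tau r" for r
      by (simp add: fisher_bingham_scale_def)
  qed simp_all
qed

lemma partial_tau_tangential_asymp: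
  assumes gap: "\<forall>i\<in>-{k}. lam $ i < lam $ k" and j: "j \<noteq> k"
  shows "eq_times_1_plus_o1 (\<lambda>r. partial_deriv j (\<lambda>t. fisher_bingham lam t r) tau)
    (\<lambda>r. tau $ j / (2 * (lam $ k - lam $ j)) * fisher_bingham lam tau r)"
proof (cases "tau $ j = 0")
  case True
  then show ?thesis
    by (intro eq_times_1_plus_o1_zero) (simp_all add: fisher_bingham_partial_tau sphere_moment_eq_0_if_odd)
next
  case False
  show ?thesis
  proof (rule eq_times_1_plus_o1_fisher_bingham[OF gap fisher_bingham_partial_tau(2),
        where c="tau $ j / (2 * (lam $ k - lam $ j))"])
    have a: "lam $ k - lam $ j > 0" using gap j by simp
    have "((\<lambda>r. (LINT t|sphere_measure r. t $ j * exp (fisher_bingham_exponent lam tau t)) /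
        (1 * fisher_bingham_scale lam tau k r)) \<longlongrightarrow>
        (LINT w|PiM (-{k}) (\<lambda>_. lborel). w j * exp (gaussian_exponent lam tau k w))) at_top"
    proof (rule sphere_even_moment_tendsto[where \<gamma>="\<lambda>r w. w j / gnomonic_scale k r w", OF gap])
      show "\<bar>w j / gnomonic_scale k r w\<bar> \<le> 1 + tangential_norm2 k r w" for r w
      proof -
        have "\<bar>x\<bar> \<le> 1 + x\<^sup>2" for x :: real
          using sum_squares_bound[of 1 "\<bar>x\<bar>"] by simp
        from this[of "w j / gnomonic_scale k r w"] show ?thesis
          using coordinate_power2_le_tangential_norm2[OF j, of w r] by linarith
      qed
    qed (use j in \<open>auto intro!: continuous_intros gnomonic_coordinate_tendsto simp: gnomonic_point_def\<close>)
    then show "((\<lambda>r. (LINT t|sphere_measure r. t $ j * exp (fisher_bingham_exponent lam tau t)) /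
        fisher_bingham_scale lam tau k r) \<longlongrightarrow> tau $ j / (2 * (lam $ k - lam $ j)) * gaussian_mass lam tau k) at_top"
      unfolding gaussian_coordinate_integral[where tau=tau and u="\<lambda>x. x", OF gap j
          gaussian_has_bochner_integral(2)[OF a]] by simp
    show "tau $ j / (2 * (lam $ k - lam $ j)) \<noteq> 0" using False a by simp
  qed (use fisher_bingham_scale_pos[of lam tau k] in \<open>auto simp: less_imp_neq[symmetric]\<close>)
qed

lemma gaussian_mass_reindex:
  assumes bij: "bij_betw e {2..d} (-{k})" and d: "d \<ge> 2"
    and gap: "\<forall>i\<in>-{k}. lam $ i < lam $ k"
  shows "gaussian_mass lam tau k =
    pi powr ((real d - 1) / 2) / (\<Prod>i=2..d. (lam $ k - lam $ e i) powr (1 / 2)) *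
      exp (- (\<Sum>i=2..d. (tau $ e i)\<^sup>2 / (4 * (lam $ e i - lam $ k))))"
proof -
  have "gaussian_mass lam tau k = (\<Prod>i=2..d. sqrt (pi / (lam $ k - lam $ e i)) *
      exp ((tau $ e i)\<^sup>2 / (4 * (lam $ k - lam $ e i))))"
    unfolding gaussian_mass_def by (rule prod.reindex_bij_betw[OF bij, symmetric])
  also have "\<dots> = (\<Prod>i=2..d. sqrt pi / (lam $ k - lam $ e i) powr (1 / 2) *
      exp (- ((tau $ e i)\<^sup>2 / (4 * (lam $ e i - lam $ k)))))"
  proof (rule prod.cong[OF refl])
    fix i assume "i \<in> {2..d}"
    then have a: "lam $ k - lam $ e i > 0" using gap bij by (auto simp: bij_betw_def)
    have "4 * (lam $ e i - lam $ k) = - (4 * (lam $ k - lam $ e i))" by simp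
    then have neg: "- ((tau $ e i)\<^sup>2 / (4 * (lam $ e i - lam $ k))) =
        (tau $ e i)\<^sup>2 / (4 * (lam $ k - lam $ e i))"
      by (metis minus_divide_right minus_minus)
    show "sqrt (pi / (lam $ k - lam $ e i)) * exp ((tau $ e i)\<^sup>2 / (4 * (lam $ k - lam $ e i))) =
        sqrt pi / (lam $ k - lam $ e i) powr (1 / 2) *
          exp (- ((tau $ e i)\<^sup>2 / (4 * (lam $ e i - lam $ k))))"
      by (simp only: neg real_sqrt_divide powr_half_sqrt[OF less_imp_le[OF a]])
  qed
  also have "\<dots> = sqrt pi ^ (d - 1) / (\<Prod>i=2..d. (lam $ k - lam $ e i) powr (1 / 2)) *
      exp (- (\<Sum>i=2..d. (tau $ e i)\<^sup>2 / (4 * (lam $ e i - lam $ k))))"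
    by (simp only: prod.distrib prod_dividef exp_sum[OF finite_atLeastAtMost] sum_negf[symmetric]
        prod_constant card_atLeastAtMost) (simp add: numeral_2_eq_2)
  also have "sqrt pi ^ (d - 1) = pi powr ((real d - 1) / 2)"
  proof -
    have "sqrt pi ^ (d - 1) = (pi powr (1 / 2)) powr real (d - 1)"
      by (simp add: powr_half_sqrt powr_realpow)
    also have "\<dots> = pi powr ((real d - 1) / 2)"
      using d by (simp add: powr_powr of_nat_diff)
    finally show ?thesis .
  qed
  finally show ?thesis .
qed

theorem proposition3p1:
  fixes lam tau :: "real ^ 'n::finite" and d :: nat and e :: "nat \<Rightarrow> 'n"
  assumes d: "d = CARD('n)" "d \<ge> 2"
    and e: "bij_betw e {1..d} UNIV"
    and neg: "0 > lam $ e 1"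
    and gap: "lam $ e 1 > lam $ e 2"
    and mono: "antimono_on {2..d} (\<lambda>i. lam $ e i)"
  shows
    "(\<forall>r>0. \<forall>j. partially_differentiable j (\<lambda>l. fisher_bingham l tau r) lam
             \<and> partially_differentiable j (\<lambda>t. fisher_bingham lam t r) tau)
   \<and> (eq_times_1_plus_o1 (\<lambda>r. fisher_bingham lam tau r)
       (\<lambda>r. pi powr ((real d - 1) / 2) / (\<Prod>i=2..d. (lam $ e 1 - lam $ e i) powr (1 / 2))
            * (exp (r * tau $ e 1) + exp (- r * tau $ e 1))
            * exp (r\<^sup>2 * lam $ e 1
                   - (\<Sum>i=2..d. (tau $ e i)\<^sup>2 / (4 * (lam $ e i - lam $ e 1))))))
   \<and> (eq_times_1_plus_o1 (\<lambda>r. partial_deriv (e 1) (\<lambda>l. fisher_bingham l tau r) lam)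
       (\<lambda>r. r\<^sup>2 * fisher_bingham lam tau r))
   \<and> (\<forall>j\<in>{2..d}. eq_times_1_plus_o1 (\<lambda>r. partial_deriv (e j) (\<lambda>l. fisher_bingham l tau r) lam)
       (\<lambda>r. ((tau $ e j / (2 * (lam $ e j - lam $ e 1)))\<^sup>2 + 1 / (2 * (lam $ e 1 - lam $ e j)))
            * fisher_bingham lam tau r))
   \<and> (eq_times_1_plus_o1 (\<lambda>r. partial_deriv (e 1) (\<lambda>t. fisher_bingham lam t r) tau)
       (\<lambda>r. r * ((exp (r * tau $ e 1) - exp (- r * tau $ e 1))
                 / (exp (r * tau $ e 1) + exp (- r * tau $ e 1)))
            * fisher_bingham lam tau r))
   \<and> (\<forall>j\<in>{2..d}. eq_times_1_plus_o1 (\<lambda>r. partial_deriv (e j) (\<lambda>t. fisher_bingham lam t r) tau)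
       (\<lambda>r. tau $ e j / (2 * (lam $ e 1 - lam $ e j)) * fisher_bingham lam tau r))"
proof -
  let ?k = "e 1"
  have bij: "bij_betw e {2..d} (-{?k})"
  proof -
    have "{2..d} = {1..d} - {1}" by auto
    moreover have "bij_betw e ({1..d} - {1}) (UNIV - {?k})"
      using e d(2) by (intro bij_betw_DiffI bij_betw_singletonI) auto
    ultimately show ?thesis by (simp add: Compl_eq_Diff_UNIV)
  qed
  have e_neq: "e j \<noteq> ?k" if "j \<in> {2..d}" for j
    using bij_betw_apply[OF bij that] by simp
  have lam_less: "\<forall>i\<in>-{?k}. lam $ i < lam $ ?k"
  proof
    fix i assume "i \<in> -{?k}"
    then obtain m where m: "m \<in> {2..d}" "i = e m"
      using bij unfolding bij_betw_def by blast
    have "lam $ e m \<le> lam $ e 2"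
      using monotone_onD[OF mono, of 2 m] m(1) d(2) by simp
    then show "lam $ i < lam $ ?k" using gap m(2) by simp
  qed
  have diff: "\<forall>r>0. \<forall>j. partially_differentiable j (\<lambda>l. fisher_bingham l tau r) lam
      \<and> partially_differentiable j (\<lambda>t. fisher_bingham lam t r) tau"
    by (simp add: fisher_bingham_partial_lam fisher_bingham_partial_tau)
  have leading: "eq_times_1_plus_o1 (\<lambda>r. fisher_bingham lam tau r)
       (\<lambda>r. pi powr ((real d - 1) / 2) / (\<Prod>i=2..d. (lam $ ?k - lam $ e i) powr (1 / 2))
            * (exp (r * tau $ ?k) + exp (- r * tau $ ?k))
            * exp (r\<^sup>2 * lam $ ?k
                   - (\<Sum>i=2..d. (tau $ e i)\<^sup>2 / (4 * (lam $ e i - lam $ ?k)))))"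
    (is "eq_times_1_plus_o1 _ ?B")
  proof (rule eq_times_1_plus_o1I)
    let ?L = "gaussian_mass lam tau ?k" and ?W = "fisher_bingham_scale lam tau ?k"
    have pos: "?L > 0" "\<And>r. ?W r > 0"
      using gaussian_mass_pos[OF lam_less] fisher_bingham_scale_pos by auto
    have B: "?B r = ?L * ?W r" for r
      unfolding gaussian_mass_reindex[OF bij d(2) lam_less] fisher_bingham_scale_def
        diff_conv_add_uminus exp_add by simp
    show "?B r \<noteq> 0" for r unfolding B using pos(1) pos(2)[of r] by simp
    have "((\<lambda>r. fisher_bingham lam tau r / ?W r / ?L) \<longlongrightarrow> ?L / ?L) at_top"
      using pos by (intro tendsto_intros fisher_bingham_tendsto[OF lam_less]) auto
    then show "((\<lambda>r. fisher_bingham lam tau r / ?B r) \<longlongrightarrow> 1) at_top"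
      unfolding B using pos by (simp add: mult.commute)
  qed
  have sq: "(x / (2 * (a - b)))\<^sup>2 = (x / (2 * (b - a)))\<^sup>2" for x a b :: real
    by (simp add: power_divide power_mult_distrib power2_commute)
  show ?thesis
    using diff leading partial_lam_leading_asymp[OF lam_less, of tau]
      partial_tau_leading_asymp[OF lam_less, of tau]
      partial_lam_tangential_asymp[OF lam_less e_neq, of _ tau]
      partial_tau_tangential_asymp[OF lam_less e_neq, of _ tau]
    unfolding sq[of _ "lam $ e _" "lam $ e 1"] mult_minus_left by blast
qed

end
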